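(* Let $\mu_1,\mu_2$ be Borel probability measures on $\mathbb{R}^n$. Define $$W_2^{\mathrm{mix}}(\mu_1,\mu_2):=\inf_{\nu\in\Pi(\mu_1,\mu_2)\cap\mathbb{GM}_{2n}}\int_{\mathbb{R}^n\times\mathbb{R}^n}\|y_1-y_2\|^2\,d\nu(y_1,y_2),$$ $$W_2^{\mathrm{prm}}:=\inf_{\pi\in\Gamma}\int_{\mathcal S\times\mathcal S}d_{\mathrm{BW}}^2\bigl(\mathcal N(s_1),\mathcal N(s_2)\bigr)\,d\pi(s_1,s_2).$$ Then $W_2^{\mathrm{mix}}(\mu_1,\mu_2)=W_2^{\mathrm{prm}}$.
   Context: $\mathbb S^d_+$ is the set of symmetric positive semidefinite $d\times d$ real matrices. $\mathcal S:=\mathbb R^n\times\mathbb S^n_+$; for $s=(m,Q)\in\mathcal S$, $\mathcal N(s)=\mathcal N(m,Q)$ is the (possibly degenerate) Gaussian law on $\mathbb R^n$ with mean $m$ and covariance $Q$. For $s_i=(m_i,Q_i)$, $$d_{\mathrm{BW}}^2(\mathcal N(s_1),\mathcal N(s_2))=\|m_1-m_2\|^2+\operatorname{tr}\bigl(Q_1+Q_2-2(Q_1^{1/2}Q_2Q_1^{1/2})^{1/2}\bigr),$$ with principal positive semidefinite square roots. $\Pi(\mu_1,\mu_2)$ is the set of Borel probability measures on $\mathbb R^n\times\mathbb R^n$ with first marginal $\mu_1$ and second marginal $\mu_2$. $\mathcal Z:=\mathbb R^n\times\mathbb R^n\times\mathbb S^{2n}_+$; for $z=((m_1,m_2),Q)\in\mathcal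 Z$, $\mathcal N(z)$ is the Gaussian law on $\mathbb R^{2n}$ with mean $(m_1,m_2)$ and covariance $Q$. $\mathbb{GM}_{2n}$ is the set of probability measures $\nu$ on $\mathbb R^{2n}$ for which there is a Borel probability measure $\lambda$ on $\mathcal Z$ with $\nu(A)=\int_{\mathcal Z}\mathcal N(z)(A)\,d\lambda(z)$ for all Borel $A$ and $\int_{\mathcal Z}\bigl(\|(m_1,m_2)\|^2+\operatorname{tr}(Q)\bigr)d\lambda<\infty$. $\Gamma$ is the set of Borel probability measures $\pi$ on $\mathcal S\times\mathcal S$ with finite second moment (i.e. $\int(\|m_1\|^2+\|m_2\|^2+\|Q_1\|_F^2+\|Q_2\|_F^2)\,d\pi<\infty$) whose marginals $\pi_1,\pi_2$ on $\mathcal S$ satisfy $\int_{\mathcal S}\mathcal N(s)(A)\,d\pi_1(s)=\mu_1(A)$ and $\int_{\mathcal S}\mathcal N(s)(B)\,d\pi_2(s)=\mu_2(B)$ for all Borel $A,B\subseteq\mathbb R^n$. The infimum of the empty set is $+\infty$. *)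

theory Defs
  imports "HOL-Probability.Probability"
begin

definition psd :: "real^'k^'k \<Rightarrow> bool" where
  "psd Q \<longleftrightarrow> transpose Q = Q \<and> (\<forall>x. 0 \<le> x \<bullet> (Q *v x))"

text \<open>The principal square root; it exists and is unique for positive semidefinite arguments,
  and is only ever used on those.\<close>

definition psd_sqrt :: "real^'k^'k \<Rightarrow> real^'k^'k" where
  "psd_sqrt Q = (THE R. psd R \<and> R ** R = Q)"

definition std_gaussian :: "(real^'k) measure" where
  "std_gaussian = density lborel (\<lambda>x. ennreal (\<Prod>i\<in>UNIV. std_normal_density (x $ i)))"

text \<open>The law of \<open>m + Q\<^sup>1\<^sup>/\<^sup>2 X\<close> with \<open>X\<close> standard Gaussian; \<open>Q\<close> may be singular.\<close>

definition gaussian :: "(real^'k) \<times> (real^'k^'k) \<Rightarrow> (real^'k) measure" where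
  "gaussian = (\<lambda>(m, Q). distr std_gaussian borel (\<lambda>x. m + psd_sqrt Q *v x))"

definition S_space :: "((real^'n) \<times> (real^'n^'n)) set" where
  "S_space = UNIV \<times> {Q. psd Q}"

text \<open>The squared Bures--Wasserstein distance of \<open>gaussian s\<^sub>1\<close> and \<open>gaussian s\<^sub>2\<close>,
  in terms of their parameters.\<close>

definition bw_dist_sq ::
    "(real^'n) \<times> (real^'n^'n) \<Rightarrow> (real^'n) \<times> (real^'n^'n) \<Rightarrow> real" where
  "bw_dist_sq = (\<lambda>(m1, Q1) (m2, Q2).
     (norm (m1 - m2))\<^sup>2 +
     trace (Q1 + Q2 - 2 *\<^sub>R psd_sqrt (psd_sqrt Q1 ** Q2 ** psd_sqrt Q1)))"

definition couplings ::
    "(real^'n) measure \<Rightarrow> (real^'n) measure \<Rightarrow> ((real^'n) \<times> (real^'n)) measure set" where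
  "couplings \<mu>1 \<mu>2 =
     {\<nu>. sets \<nu> = sets borel \<and> prob_space \<nu> \<and>
          distr \<nu> borel fst = \<mu>1 \<and> distr \<nu> borel snd = \<mu>2}"

text \<open>The index type \<open>'n + 'n\<close> has \<open>2n\<close> elements.  The two functions below are the canonical
  identification of pairs of vectors with vectors of length \<open>2n\<close> and its inverse.\<close>

definition join_vec :: "(real^'n) \<times> (real^'n) \<Rightarrow> real^('n + 'n)" where
  "join_vec p = (\<chi> i. case i of Inl j \<Rightarrow> fst p $ j | Inr j \<Rightarrow> snd p $ j)"

definition split_vec :: "real^('n + 'n) \<Rightarrow> (real^'n) \<times> (real^'n)" where
  "split_vec v = ((\<chi> j. v $ Inl j), (\<chi> j. v $ Inr j))"

lemma split_vec_join_vec: "split_vec (join_vec p) = p"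
  by (simp add: split_vec_def join_vec_def prod_eq_iff vec_eq_iff)

lemma join_vec_split_vec: "join_vec (split_vec v) = v"
  by (simp add: split_vec_def join_vec_def vec_eq_iff split: sum.split)

definition Z_space ::
    "(((real^'n) \<times> (real^'n)) \<times> (real^('n + 'n)^('n + 'n))) set" where
  "Z_space = UNIV \<times> {Q. psd Q}"

definition gaussian_pair ::
    "((real^'n) \<times> (real^'n)) \<times> (real^('n + 'n)^('n + 'n)) \<Rightarrow> ((real^'n) \<times> (real^'n)) measure" where
  "gaussian_pair = (\<lambda>(m, Q). distr (gaussian (join_vec m, Q)) borel split_vec)"

definition GM2 :: "((real^'n) \<times> (real^'n)) measure set" where
  "GM2 =
     {\<nu>. sets \<nu> = sets borel \<and> prob_space \<nu> \<and>
       (\<exists>\<Lambda>. sets \<Lambda> = sets (restrict_space borel Z_space) \<and> prob_space \<Lambda> \<and>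
         (\<forall>A\<in>sets borel. emeasure \<nu> A = (\<integral>\<^sup>+z. emeasure (gaussian_pair z) A \<partial>\<Lambda>)) \<and>
         (\<integral>\<^sup>+z. ennreal ((norm (fst z))\<^sup>2 + trace (snd z)) \<partial>\<Lambda>) < \<infinity>)}"

text \<open>The norm of \<open>real^'n^'n\<close> is the Frobenius norm.\<close>

definition param_couplings ::
    "(real^'n) measure \<Rightarrow> (real^'n) measure \<Rightarrow>
      (((real^'n) \<times> (real^'n^'n)) \<times> ((real^'n) \<times> (real^'n^'n))) measure set" where
  "param_couplings \<mu>1 \<mu>2 =
     {\<pi>. sets \<pi> = sets (restrict_space borel (S_space \<times> S_space)) \<and> prob_space \<pi> \<and>
       (\<integral>\<^sup>+((m1, Q1), (m2, Q2)).
          ennreal ((norm m1)\<^sup>2 + (norm m2)\<^sup>2 + (norm Q1)\<^sup>2 + (norm Q2)\<^sup>2) \<partial>\<pi>) < \<infinity> \<and>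
       (\<forall>A\<in>sets borel.
          (\<integral>\<^sup>+s. emeasure (gaussian s) A \<partial>(distr \<pi> (restrict_space borel S_space) fst))
            = emeasure \<mu>1 A) \<and>
       (\<forall>B\<in>sets borel.
          (\<integral>\<^sup>+s. emeasure (gaussian s) B \<partial>(distr \<pi> (restrict_space borel S_space) snd))
            = emeasure \<mu>2 B)}"

text \<open>Both infima are taken in \<open>ennreal\<close>, where the infimum of the empty set is \<open>\<infinity>\<close>.\<close>

definition W2_mix :: "(real^'n) measure \<Rightarrow> (real^'n) measure \<Rightarrow> ennreal" where
  "W2_mix \<mu>1 \<mu>2 =
     (INF \<nu>\<in>couplings \<mu>1 \<mu>2 \<inter> GM2. \<integral>\<^sup>+(y1, y2). ennreal ((norm (y1 - y2))\<^sup>2) \<partial>\<nu>)"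

definition W2_prm :: "(real^'n) measure \<Rightarrow> (real^'n) measure \<Rightarrow> ennreal" where
  "W2_prm \<mu>1 \<mu>2 =
     (INF \<pi>\<in>param_couplings \<mu>1 \<mu>2. \<integral>\<^sup>+(s1, s2). ennreal (bw_dist_sq s1 s2) \<partial>\<pi>)"

end

theory Submission
  imports Defs
begin

text \<open>
  A Gaussian with zero covariance is a point mass, and this collapses one side of the identity: a law
  on the product space is a Gaussian mixture with finite second moment iff it has finite second moment
  (\<open>GM2_iff\<close>).  So \<open>W2_mix\<close> is the ordinary squared Wasserstein distance, restricted to couplings with
  finite second moment, and the two inequalities become independent constructions.

  For \<open>W2_prm \<le> W2_mix\<close>, a coupling \<open>\<nu>\<close> is itself a coupling of point masses: sending \<open>(y\<^sub>1, y\<^sub>2)\<close> to the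
  parameters \<open>((y\<^sub>1, 0), (y\<^sub>2, 0))\<close> preserves the cost (\<open>W2_prm_le_cost\<close>).

  For \<open>W2_mix \<le> W2_prm\<close>, a law \<open>\<pi>\<close> of parameters has to be turned into a coupling whose cost is at most
  the integral of the squared Bures-Wasserstein distance, up to \<open>\<epsilon>\<close> (\<open>W2_mix_le_cost\<close>).  Given the
  parameters, couple \<open>m\<^sub>1 + Q\<^sub>1\<^sup>1\<^sup>/\<^sup>2 X\<close> and \<open>m\<^sub>2 + Q\<^sub>2\<^sup>1\<^sup>/\<^sup>2 U X\<close> for one standard Gaussian \<open>X\<close> and an
  orthogonal matrix \<open>U\<close>.  Rotation invariance makes the marginals correct, and the cost is
  \<open>\<parallel>m\<^sub>1 - m\<^sub>2\<parallel>\<^sup>2 + \<parallel>Q\<^sub>1\<^sup>1\<^sup>/\<^sup>2 - Q\<^sub>2\<^sup>1\<^sup>/\<^sup>2 U\<parallel>\<^sup>2\<close> in the Frobenius norm.  When \<open>U\<close> comes from the polar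
  decomposition of \<open>Q\<^sub>1\<^sup>1\<^sup>/\<^sup>2 Q\<^sub>2\<^sup>1\<^sup>/\<^sup>2\<close>, this is exactly the squared Bures-Wasserstein distance
  (\<open>bw_dist_sq_attained\<close>).  The rotation must depend measurably on the parameters; taking the first
  rotation of a fixed countable dense set that is optimal up to \<open>\<epsilon>\<close> achieves this
  (\<open>countable_near_optimal_rotations\<close>).

  The linear algebra behind this rests on one variational idea: a maximiser \<open>U\<close> of \<open>tr (T U)\<close> over the
  orthogonal matrices makes \<open>T U\<close> symmetric positive semidefinite (\<open>polar_decomposition\<close>).  Applied to
  a Cholesky factor of \<open>Q\<close>, it also produces the square root of \<open>Q\<close>.
\<close>

section \<open>Positive semidefinite matrices and their square roots\<close>

lemma inner_matrix_vector_mult: "x \<bullet> (A *v y) = (transpose A *v x) \<bullet> (y :: real^'k)"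
  for x :: "real^'m"
  by (simp add: dot_lmul_matrix transpose_matrix_vector)

lemma psd_transpose: "psd Q \<Longrightarrow> transpose Q = Q"
  and psd_nonneg: "psd Q \<Longrightarrow> 0 \<le> x \<bullet> (Q *v x)"
  by (auto simp: psd_def)

lemma psd_inner_commute: "psd Q \<Longrightarrow> x \<bullet> (Q *v y) = y \<bullet> (Q *v x)"
  by (metis inner_commute inner_matrix_vector_mult psd_transpose)

text \<open>The quadratic \<open>t \<mapsto> (x + t y) \<bullet> Q (x + t y)\<close> has no sign change, so its discriminant is at
  most zero; the degenerate case of a vanishing leading coefficient is handled separately.\<close>

lemma psd_cauchy_schwarz:
  assumes "psd Q"
  shows "(x \<bullet> (Q *v y))\<^sup>2 \<le> (x \<bullet> (Q *v x)) * (y \<bullet> (Q *v y))"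
proof -
  define a where "a = x \<bullet> (Q *v x)"
  define b where "b = x \<bullet> (Q *v y)"
  define c where "c = y \<bullet> (Q *v y)"
  have quad: "0 \<le> a + 2 * t * b + t\<^sup>2 * c" for t
    using psd_nonneg[OF assms, of "x + t *\<^sub>R y"] psd_inner_commute[OF assms, of y x]
    by (simp add: a_def b_def c_def algebra_simps inner_simps matrix_vector_right_distrib
        matrix_vector_mult_scaleR power2_eq_square)
  have "0 \<le> c"
    using psd_nonneg[OF assms] by (simp add: c_def)
  have "b\<^sup>2 \<le> a * c"
  proof (cases "c = 0")
    case True
    have "b = 0"
    proof (rule ccontr)
      assume "b \<noteq> 0"
      then show False
        using quad[of "- (a + 1) / (2 * b)"] True by (simp add: field_simps)
    qed
    then show ?thesis using True by simp
  next
    case False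
    with \<open>0 \<le> c\<close> have "0 < c" by simp
    \<comment> \<open>The minimum of the quadratic is at \<open>t = - b / c\<close>.\<close>
    with quad[of "- b / c"] show ?thesis
      by (simp add: field_simps power2_eq_square)
  qed
  then show ?thesis by (simp add: a_def b_def c_def)
qed

lemma psd_kernel:
  assumes "psd Q" "x \<bullet> (Q *v x) = 0"
  shows "Q *v x = 0"
proof -
  have "((Q *v x) \<bullet> (Q *v x))\<^sup>2 \<le> 0"
    using psd_cauchy_schwarz[OF assms(1), of "Q *v x" x] assms(2) by simp
  then show ?thesis by simp
qed

lemma matrix_diff_ldistrib: "A ** (B - C) = A ** B - A ** C" for A :: "real^'m^'l"
  by (simp add: vec_eq_iff matrix_matrix_mult_def right_diff_distrib sum_subtractf)

lemma matrix_diff_rdistrib: "(A - B) ** C = A ** C - B ** C" for C :: "real^'m^'l"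
  by (simp add: vec_eq_iff matrix_matrix_mult_def left_diff_distrib sum_subtractf)

lemma inner_axis_matrix: "axis i 1 \<bullet> (Q *v axis j 1) = (Q :: real^'k^'k) $ i $ j"
  by (simp add: inner_axis' matrix_vector_mult_basis column_def)

definition outer_prod :: "real^'k \<Rightarrow> real^'k \<Rightarrow> real^'k^'k" where
  "outer_prod v w = (\<chi> i j. v $ i * w $ j)"

lemma outer_prod_mult_vec: "outer_prod v w *v x = (w \<bullet> x) *\<^sub>R v"
  by (simp add: outer_prod_def vec_eq_iff matrix_vector_mult_def inner_vec_def
      sum_distrib_left mult_ac)

text \<open>Cholesky elimination, one index at a time.  If \<open>Q\<close> has a positive diagonal entry \<open>q\<close> at \<open>a\<close>, then
  subtracting the rank-one matrix \<open>v v\<^sup>T\<close> with \<open>v = Q e\<^sub>a / \<surd>q\<close> clears row \<open>a\<close>, and the Cauchy-Schwarz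
  inequality for the form \<open>Q\<close> says exactly that the rest is still positive semidefinite.  The
  hypothesis on the rows outside \<open>I\<close> records which rows have been cleared already.\<close>

lemma psd_cholesky_on:
  fixes Q :: "real^'k^'k"
  assumes "finite I" "psd Q" "\<And>i j. i \<notin> I \<Longrightarrow> Q $ i $ j = 0"
  shows "\<exists>t. \<forall>i j. Q $ i $ j = (\<Sum>k\<in>I. t k $ i * (t k :: real^'k) $ j)"
  using assms
proof (induction I arbitrary: Q rule: finite_induct)
  case empty
  then show ?case by simp
next
  case (insert a I)
  have sym: "Q $ i $ j = Q $ j $ i" for i j
    using arg_cong[OF psd_transpose[OF insert.prems(1)], of "\<lambda>M. M $ j $ i"]
    by (simp add: transpose_def)
  define q where "q = Q $ a $ a"
  have "0 \<le> q"
    using psd_nonneg[OF insert.prems(1), of "axis a 1"] by (simp add: q_def inner_axis_matrix)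
  \<comment> \<open>If \<open>q = 0\<close>, division by zero gives \<open>v = 0\<close>, which is right: row \<open>a\<close> of \<open>Q\<close> is then zero.\<close>
  define v where "v = (1 / sqrt q) *\<^sub>R (Q *v axis a 1)"
  have v_nth: "v $ i = Q $ i $ a / sqrt q" for i
    by (simp add: v_def matrix_vector_mult_basis column_def)
  have row_a: "Q $ a $ j = 0" if "q = 0" for j
  proof -
    have "Q *v axis a 1 = 0"
      using that by (intro psd_kernel[OF insert.prems(1)]) (simp add: q_def inner_axis_matrix)
    then show ?thesis
      using sym[of a j] by (simp add: matrix_vector_mult_basis column_def vec_eq_iff)
  qed
  define Q' where "Q' = Q - outer_prod v v"
  have Q'_nth: "Q' $ i $ j = Q $ i $ j - v $ i * v $ j" for i j
    by (simp add: Q'_def outer_prod_def)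
  have Q'_mult: "Q' *v x = Q *v x - (v \<bullet> x) *\<^sub>R v" for x
    by (simp add: Q'_def matrix_vector_mult_diff_rdistrib outer_prod_mult_vec)
  have "psd Q'"
    unfolding psd_def
  proof (intro conjI allI)
    show "transpose Q' = Q'"
      using sym by (simp add: Q'_nth transpose_def vec_eq_iff mult.commute)
    fix x
    have "(x \<bullet> (Q *v axis a 1))\<^sup>2 \<le> (x \<bullet> (Q *v x)) * q"
      using psd_cauchy_schwarz[OF insert.prems(1), of x "axis a 1"]
      by (simp add: q_def inner_axis_matrix)
    then have "(v \<bullet> x)\<^sup>2 \<le> x \<bullet> (Q *v x)"
      using \<open>0 \<le> q\<close> psd_nonneg[OF insert.prems(1), of x]
      by (cases "q = 0") (simp_all add: v_def inner_commute power_divide field_simps)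
    then show "0 \<le> x \<bullet> (Q' *v x)"
      by (simp add: Q'_mult inner_diff_right power2_eq_square inner_commute)
  qed
  moreover have "Q' $ i $ j = 0" if "i \<notin> I" for i j
  proof (cases "i = a")
    case True
    then show ?thesis
      using \<open>0 \<le> q\<close> row_a sym[of a j]
      by (cases "q = 0") (simp_all add: Q'_nth v_nth q_def)
  next
    case False
    then show ?thesis
      using that insert.prems(2)[of i] by (simp add: Q'_nth v_nth)
  qed
  ultimately obtain t where t: "\<And>i j. Q' $ i $ j = (\<Sum>k\<in>I. t k $ i * (t k :: real^'k) $ j)"
    using insert.IH by blast
  have "Q $ i $ j = (\<Sum>k\<in>insert a I. (t(a := v)) k $ i * (t(a := v)) k $ j)" for i j
  proof -
    have "(\<Sum>k\<in>I. (t(a := v)) k $ i * (t(a := v)) k $ j) = Q' $ i $ j"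
      unfolding t using insert.hyps by (intro sum.cong) auto
    then show ?thesis
      using insert.hyps by (simp add: Q'_nth)
  qed
  then show ?case by blast
qed

lemma psd_factorization:
  fixes Q :: "real^'k^'k"
  assumes "psd Q"
  obtains T :: "real^'k^'k" where "Q = T ** transpose T"
proof -
  have "\<exists>t. \<forall>i j. Q $ i $ j = (\<Sum>k\<in>(UNIV::'k set). t k $ i * (t k :: real^'k) $ j)"
    by (rule psd_cholesky_on[OF finite assms]) simp
  then obtain t where t: "\<And>i j. Q $ i $ j = (\<Sum>k\<in>(UNIV::'k set). t k $ i * (t k :: real^'k) $ j)"
    by blast
  have "Q = (\<chi> i j. t j $ i) ** transpose (\<chi> i j. t j $ i)"
    by (simp add: vec_eq_iff matrix_matrix_mult_def transpose_def t)
  then show thesis by (rule that)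
qed

lemma power2_norm_matrix: "(norm A)\<^sup>2 = trace (transpose A ** A)" for A :: "real^'n^'m"
  unfolding power2_norm_eq_inner trace_def
  by (simp add: inner_vec_def matrix_matrix_mult_def transpose_def) (rule sum.swap)

lemma compact_orthogonal_matrices: "compact {U :: real^'k^'k. orthogonal_matrix U}"
proof -
  have "norm U = sqrt (CARD('k))" if "orthogonal_matrix U" for U :: "real^'k^'k"
    using that power2_norm_matrix[of U]
    by (metis orthogonal_matrix trace_I norm_ge_zero real_sqrt_unique)
  then have "bounded {U :: real^'k^'k. orthogonal_matrix U}"
    unfolding bounded_iff by auto
  moreover have "closed {U :: real^'k^'k. orthogonal_matrix U}"
    unfolding orthogonal_matrix matrix_matrix_mult_def transpose_def
    by (intro closed_Collect_eq continuous_intros)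
  ultimately show ?thesis
    by (simp add: compact_eq_bounded_closed)
qed

lemma continuous_on_trace_mult: "continuous_on S (\<lambda>U. trace (T ** U))"
  for T :: "real^'m^'k" and S :: "(real^'k^'m) set"
  unfolding trace_def matrix_matrix_mult_def by (intro continuous_intros)

lemma trace_mult_outer_prod: "trace (P ** outer_prod v w) = w \<bullet> (P *v v)"
  unfolding trace_def matrix_matrix_mult_def inner_vec_def matrix_vector_mult_def outer_prod_def
  by (simp add: sum_distrib_left mult_ac)

text \<open>The Householder reflection in the hyperplane orthogonal to \<open>v\<close>, provided that \<open>v\<close> is a unit vector.\<close>

definition reflection :: "real^'k \<Rightarrow> real^'k^'k" where
  "reflection v = mat 1 - 2 *\<^sub>R outer_prod v v"

lemma reflection_mult_vec: "reflection v *v x = x - (2 * (v \<bullet> x)) *\<^sub>R v"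
proof -
  have "(2 *\<^sub>R outer_prod v v) *v x = 2 *\<^sub>R (outer_prod v v *v x)"
    by (rule scaleR_matrix_vector_assoc[symmetric])
  then show ?thesis
    by (simp add: reflection_def matrix_vector_mult_diff_rdistrib outer_prod_mult_vec)
qed

lemma orthogonal_matrix_reflection:
  assumes "norm v = 1"
  shows "orthogonal_matrix (reflection v)"
proof -
  have [simp]: "v \<bullet> v = 1"
    using assms by (simp add: norm_eq_1)
  have "transpose (reflection v) = reflection v"
    by (simp add: reflection_def transpose_def vec_eq_iff mat_def outer_prod_def mult.commute)
  moreover have "reflection v ** reflection v = mat 1"
    by (simp add: matrix_eq matrix_vector_mul_assoc[symmetric] reflection_mult_vec inner_diff_right
        scaleR_left_diff_distrib[symmetric])
  ultimately show ?thesis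
    by (simp add: orthogonal_matrix)
qed

lemma trace_mult_reflections:
  "trace (P ** (reflection u ** reflection v))
    = trace P - 2 * (u \<bullet> (P *v u)) - 2 * (v \<bullet> (P *v v)) + 4 * (u \<bullet> v) * (v \<bullet> (P *v u))"
proof -
  have "reflection u ** reflection v
      = mat 1 - 2 *\<^sub>R outer_prod u u - 2 *\<^sub>R outer_prod v v + (4 * (u \<bullet> v)) *\<^sub>R outer_prod u v"
    by (simp add: matrix_eq matrix_vector_mul_assoc[symmetric] reflection_mult_vec inner_diff_right
        matrix_vector_mult_diff_rdistrib matrix_vector_mult_add_rdistrib
        scaleR_matrix_vector_assoc[symmetric] outer_prod_mult_vec algebra_simps)
  moreover have "trace (P ** (c *\<^sub>R M)) = c * trace (P ** M)" for c and M :: "real^'a^'a"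
    by (simp add: trace_def matrix_matrix_mult_def sum_distrib_left mult_ac)
  ultimately show ?thesis
    by (simp add: matrix_add_ldistrib matrix_diff_ldistrib trace_add trace_sub
        trace_mult_outer_prod)
qed

text \<open>First-order optimality on the orthogonal group, tested with reflections only.  A single reflection
  gives nonnegativity of the form.  A product of two reflections in directions \<open>e\<^sub>i\<close> and
  \<open>e\<^sub>i + t e\<^sub>j\<close> is a rotation by an angle of order \<open>t\<close>; the part of the trace that is linear in
  \<open>t\<close> is proportional to \<open>P\<^sub>i\<^sub>j - P\<^sub>j\<^sub>i\<close> and has to vanish.\<close>

lemma psd_if_trace_maximal:
  fixes P :: "real^'k^'k"
  assumes max: "\<And>V. orthogonal_matrix V \<Longrightarrow> trace (P ** V) \<le> trace P"
  shows "psd P"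
  unfolding psd_def
proof (intro conjI allI)
  have two: "2 * (u \<bullet> v) * (v \<bullet> (P *v u)) \<le> u \<bullet> (P *v u) + v \<bullet> (P *v v)"
    if "norm u = 1" "norm v = 1" for u v
    using max[OF orthogonal_matrix_mul[OF orthogonal_matrix_reflection[OF that(1)]
        orthogonal_matrix_reflection[OF that(2)]]]
    by (simp add: trace_mult_reflections)
  show "transpose P = P"
  proof -
    have "P $ i $ j = P $ j $ i" if "i \<noteq> j" for i j
    proof -
      define d where "d = P $ i $ j - P $ j $ i"
      define K where "K = P $ i $ i + P $ j $ j"
      have turn: "t * d \<le> t\<^sup>2 * K" for t
      proof -
        define c where "c = 1 / sqrt (1 + t\<^sup>2)"
        have pos: "0 < 1 + t\<^sup>2" by (simp add: add_pos_nonneg)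
        have c2: "c * c = 1 / (1 + t\<^sup>2)"
          using pos by (simp add: c_def)
        define u :: "real^'k" where "u = c *\<^sub>R (axis i 1 + t *\<^sub>R axis j 1)"
        have ax: "axis i 1 \<bullet> (axis i 1 :: real^'k) = 1" "axis j 1 \<bullet> (axis j 1 :: real^'k) = 1"
          "axis i 1 \<bullet> (axis j 1 :: real^'k) = 0" "axis j 1 \<bullet> (axis i 1 :: real^'k) = 0"
          using that by (simp_all add: inner_axis_axis)
        have "u \<bullet> u = (c * c) * (1 + t\<^sup>2)"
          by (simp add: u_def inner_simps ax power2_eq_square algebra_simps)
        also have "\<dots> = 1" using pos by (simp add: c2)
        finally have "norm u = 1" by (simp add: norm_eq_1)
        then have ineq: "2 * (u \<bullet> axis i 1) * (axis i 1 \<bullet> (P *v u))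
            \<le> u \<bullet> (P *v u) + axis i 1 \<bullet> (P *v axis i 1)"
          by (intro two) simp_all
        define X where "X = P $ i $ i + t * P $ i $ j"
        define Y where "Y = P $ i $ i + t * (P $ i $ j + P $ j $ i) + t\<^sup>2 * P $ j $ j"
        from ineq have "(c * c) * (2 * X) \<le> (c * c) * Y + P $ i $ i"
          by (simp add: u_def X_def Y_def inner_simps ax matrix_vector_mult_scaleR
              matrix_vector_right_distrib inner_axis_matrix algebra_simps power2_eq_square)
        then have "2 * X / (1 + t\<^sup>2) \<le> Y / (1 + t\<^sup>2) + P $ i $ i"
          by (simp add: c2)
        moreover have "2 * X \<le> Y + s * p" if "0 < s" "2 * X / s \<le> Y / s + p" for s p
          using that by (simp add: field_simps)
        ultimately have "2 * X \<le> Y + (1 + t\<^sup>2) * P $ i $ i"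
          using pos by blast
        then show ?thesis
          by (simp add: X_def Y_def d_def K_def algebra_simps)
      qed
      show ?thesis
      proof (rule ccontr)
        assume "\<not> ?thesis"
        then have "0 < d\<^sup>2" by (simp add: d_def)
        define k where "k = \<bar>K\<bar> + 1"
        have "0 < k" "K < k" by (simp_all add: k_def)
        \<comment> \<open>At \<open>t = d / k\<close> the linear term beats the quadratic one, since \<open>K < k\<close>.\<close>
        have "d\<^sup>2 * k \<le> d\<^sup>2 * K"
          using turn[of "d / k"] \<open>0 < k\<close> by (simp add: power2_eq_square field_simps)
        then show False
          using \<open>0 < d\<^sup>2\<close> \<open>K < k\<close> by simp
      qed
    qed
    then show ?thesis
      by (simp add: vec_eq_iff transpose_def) metis
  qed
  fix x
  show "0 \<le> x \<bullet> (P *v x)"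
  proof (cases "x = 0")
    case False
    define e where "e = (1 / norm x) *\<^sub>R x"
    have "norm e = 1" using False by (simp add: e_def)
    then have "e \<bullet> e = 1" by (simp add: norm_eq_1)
    have "trace (P ** reflection e) \<le> trace P"
      by (rule max) (rule orthogonal_matrix_reflection[OF \<open>norm e = 1\<close>])
    moreover have "trace (P ** reflection e) = trace P - 2 * (e \<bullet> (P *v e))"
    proof -
      have "trace (P ** (2 *\<^sub>R outer_prod e e)) = 2 * trace (P ** outer_prod e e)"
        by (simp add: trace_def matrix_matrix_mult_def sum_distrib_left mult_ac)
      then show ?thesis
        by (simp add: reflection_def matrix_diff_ldistrib trace_sub trace_mult_outer_prod)
    qed
    ultimately have "0 \<le> e \<bullet> (P *v e)" by simp
    then show ?thesis
      using False by (auto simp: e_def matrix_vector_mult_scaleR zero_le_divide_iff mult_le_0_iff)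
  qed simp
qed

text \<open>Since the orthogonal group is compact, some \<open>U\<close> maximises \<open>tr (T U)\<close>.  Unlike a construction
  that inverts \<open>(T T\<^sup>T)\<^sup>1\<^sup>/\<^sup>2\<close>, this covers singular \<open>T\<close>, and it presupposes no spectral theorem.
  It serves twice: for the existence of square roots and for an optimal coupling of two Gaussians.\<close>

lemma polar_decomposition:
  fixes T :: "real^'k^'k"
  obtains U where "orthogonal_matrix U" "psd (T ** U)"
proof -
  have "{U :: real^'k^'k. orthogonal_matrix U} \<noteq> {}"
    using orthogonal_matrix_id by blast
  then obtain U :: "real^'k^'k" where U: "orthogonal_matrix U"
    and max: "\<And>V :: real^'k^'k. orthogonal_matrix V \<Longrightarrow> trace (T ** V) \<le> trace (T ** U)"
    using continuous_attains_sup[OF compact_orthogonal_matrices _ continuous_on_trace_mult, of T]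
    by auto
  have "psd (T ** U)"
    using max orthogonal_matrix_mul[OF U]
    by (intro psd_if_trace_maximal) (simp add: matrix_mul_assoc[symmetric])
  with U show thesis by (rule that)
qed

lemma polar_square:
  assumes "orthogonal_matrix U" "psd (T ** U)"
  shows "(T ** U) ** (T ** U) = T ** transpose T"
proof -
  have "(T ** U) ** (T ** U) = (T ** U) ** transpose (T ** U)"
    using psd_transpose[OF assms(2)] by simp
  also have "\<dots> = T ** (U ** transpose U) ** transpose T"
    by (simp add: matrix_transpose_mul matrix_mul_assoc)
  also have "\<dots> = T ** transpose T"
    using assms(1) by (simp add: orthogonal_matrix_def)
  finally show ?thesis .
qed

text \<open>With \<open>D = R - S\<close>, the identity \<open>R D + D S = R\<^sup>2 - S\<^sup>2 = 0\<close> yields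
  \<open>tr (D R D) + tr (D S D) = 0\<close>.  Both traces are sums of values of positive semidefinite forms at
  the columns of \<open>D\<close>, so \<open>R\<close> and \<open>S\<close> annihilate these columns, whence \<open>D\<^sup>2 = 0\<close> and \<open>D = 0\<close>.\<close>

lemma psd_square_root_unique:
  fixes R S :: "real^'k^'k"
  assumes "psd R" "psd S" "R ** R = S ** S"
  shows "R = S"
proof -
  define D where "D = R - S"
  have D_sym: "transpose D = D"
    using psd_transpose[OF assms(1)] psd_transpose[OF assms(2)]
    by (simp add: D_def transpose_def vec_eq_iff)
  have "R ** D + D ** S = 0"
    by (simp add: D_def matrix_diff_ldistrib matrix_diff_rdistrib assms(3))
  then have comm: "R ** D = - (D ** S)"
    by (simp add: eq_neg_iff_add_eq_0)
  have tr: "trace (D ** (M ** D)) = (\<Sum>i\<in>UNIV. (D *v axis i 1) \<bullet> (M *v (D *v axis i 1)))" for M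
  proof -
    have "trace (D ** (M ** D)) = (\<Sum>i\<in>UNIV. axis i 1 \<bullet> (D *v (M *v (D *v axis i 1))))"
      by (simp add: trace_def matrix_vector_mul_assoc inner_axis_matrix)
    then show ?thesis
      by (simp add: inner_matrix_vector_mult[of _ D] D_sym)
  qed
  have "trace (D ** (R ** D)) = - trace (D ** (D ** S))"
    by (simp add: comm) (simp add: trace_def matrix_matrix_mult_def sum_negf)
  also have "trace (D ** (D ** S)) = trace (D ** (S ** D))"
    by (metis matrix_mul_assoc trace_mul_sym)
  finally have "(\<Sum>i\<in>UNIV. (D *v axis i 1) \<bullet> (R *v (D *v axis i 1)))
      + (\<Sum>i\<in>UNIV. (D *v axis i 1) \<bullet> (S *v (D *v axis i 1))) = 0"
    by (simp add: tr)
  moreover have "0 \<le> (\<Sum>i\<in>UNIV. (D *v axis i 1) \<bullet> (R *v (D *v axis i 1)))"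
    "0 \<le> (\<Sum>i\<in>UNIV. (D *v axis i 1) \<bullet> (S *v (D *v axis i 1)))"
    using assms(1,2) by (auto intro!: sum_nonneg psd_nonneg)
  ultimately have "(\<Sum>i\<in>UNIV. (D *v axis i 1) \<bullet> (R *v (D *v axis i 1))) = 0"
    "(\<Sum>i\<in>UNIV. (D *v axis i 1) \<bullet> (S *v (D *v axis i 1))) = 0"
    by linarith+
  then have "(D *v axis i 1) \<bullet> (R *v (D *v axis i 1)) = 0"
    "(D *v axis i 1) \<bullet> (S *v (D *v axis i 1)) = 0" for i
    by (simp_all add: sum_nonneg_eq_0_iff psd_nonneg[OF assms(1)] psd_nonneg[OF assms(2)])
  then have "R *v (D *v axis i 1) = 0" "S *v (D *v axis i 1) = 0" for i
    using psd_kernel assms(1,2) by blast+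
  then have "D *v (D *v axis i 1) = 0" for i
    by (metis D_def diff_0_right matrix_vector_mult_diff_rdistrib)
  then have "(D *v axis i 1) \<bullet> (D *v axis i 1) = 0" for i
    by (metis D_sym inner_matrix_vector_mult inner_zero_right)
  then have "D *v axis i 1 = 0" for i
    by simp
  then have "D = 0"
    by (simp add: vec_eq_iff matrix_vector_mult_basis column_def)
  then show ?thesis by (simp add: D_def)
qed

text \<open>If \<open>Q = T T\<^sup>T\<close> and \<open>T U\<close> is the positive semidefinite polar factor of \<open>T\<close>, then \<open>T U\<close> is a
  square root of \<open>Q\<close>.\<close>

lemma ex1_psd_square_root:
  assumes "psd Q"
  shows "\<exists>!R. psd R \<and> R ** R = (Q :: real^'k^'k)"
proof -
  obtain T :: "real^'k^'k" where T: "Q = T ** transpose T"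
    by (rule psd_factorization[OF assms])
  obtain U where "orthogonal_matrix U" "psd (T ** U)"
    by (rule polar_decomposition)
  then have "psd (T ** U) \<and> (T ** U) ** (T ** U) = Q"
    by (simp add: polar_square T)
  then show ?thesis
    using psd_square_root_unique by blast
qed

lemma
  assumes "psd Q"
  shows psd_psd_sqrt: "psd (psd_sqrt Q)"
    and psd_sqrt_mult_self: "psd_sqrt Q ** psd_sqrt Q = Q"
  using theI'[OF ex1_psd_square_root[OF assms]] by (simp_all add: psd_sqrt_def)

lemma psd_sqrt_unique: "psd R \<Longrightarrow> psd_sqrt (R ** R) = R"
  unfolding psd_sqrt_def by (rule the_equality) (auto intro: psd_square_root_unique)

lemma psd_0: "psd 0"
  by (simp add: psd_def transpose_def vec_eq_iff)

lemma psd_sqrt_0 [simp]: "psd_sqrt 0 = 0"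
  using psd_sqrt_unique[OF psd_0] by simp

lemma power2_norm_psd_sqrt: "psd Q \<Longrightarrow> (norm (psd_sqrt Q))\<^sup>2 = trace Q"
  by (simp add: power2_norm_matrix psd_transpose psd_psd_sqrt psd_sqrt_mult_self)

lemma psd_congruence:
  assumes "psd Q"
  shows "psd (A ** Q ** transpose A)"
  unfolding psd_def
proof (intro conjI allI)
  show "transpose (A ** Q ** transpose A) = A ** Q ** transpose A"
    by (simp add: matrix_transpose_mul psd_transpose[OF assms] matrix_mul_assoc)
  show "0 \<le> x \<bullet> ((A ** Q ** transpose A) *v x)" for x
    using psd_nonneg[OF assms, of "transpose A *v x"]
    by (simp add: matrix_vector_mul_assoc[symmetric] inner_matrix_vector_mult[of x])
qed

lemma closed_psd: "closed {Q :: real^'k^'k. psd Q}"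
proof -
  have "{Q :: real^'k^'k. psd Q} = {Q. transpose Q = Q} \<inter> (\<Inter>x. {Q. 0 \<le> x \<bullet> (Q *v x)})"
    by (auto simp: psd_def)
  also have "closed \<dots>"
    unfolding transpose_def matrix_vector_mult_def inner_vec_def
    by (intro closed_Int closed_INT ballI closed_Collect_eq closed_Collect_le continuous_intros)
  finally show ?thesis .
qed

text \<open>The graph of the square root is closed, because it is the graph of squaring read backwards, and on
  matrices of bounded trace the square root takes values in a compact ball.\<close>

lemma continuous_on_psd_sqrt: "continuous_on {Q :: real^'k^'k. psd Q} psd_sqrt"
proof -
  have bounded_trace: "continuous_on {Q :: real^'k^'k. psd Q \<and> trace Q \<le> c} psd_sqrt" for c
  proof (rule continuous_from_closed_graph)
    show "compact (cball 0 (sqrt c) :: (real^'k^'k) set)" by simp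
    show "psd_sqrt \<in> {Q :: real^'k^'k. psd Q \<and> trace Q \<le> c} \<rightarrow> cball 0 (sqrt c)"
      by (auto intro!: real_le_rsqrt simp: power2_norm_psd_sqrt)
    have "(\<lambda>Q. (Q, psd_sqrt Q)) ` {Q :: real^'k^'k. psd Q \<and> trace Q \<le> c}
        = {p. psd (fst p) \<and> trace (fst p) \<le> c \<and> psd (snd p) \<and> snd p ** snd p = fst p}"
      using psd_psd_sqrt psd_sqrt_mult_self psd_sqrt_unique by (force simp: image_iff)
    also have "\<dots> = (fst -` {Q. psd Q}) \<inter> {p. trace (fst p) \<le> c} \<inter> (snd -` {Q. psd Q})
        \<inter> {p. snd p ** snd p = fst p}"
      by auto
    also have "closed \<dots>"
      unfolding trace_def matrix_matrix_mult_def
      by (intro closed_Int closed_vimage closed_psd closed_Collect_eq closed_Collect_le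
          continuous_intros)
    finally show "closed ((\<lambda>Q. (Q, psd_sqrt Q)) ` {Q :: real^'k^'k. psd Q \<and> trace Q \<le> c})" .
  qed
  have cont_trace: "continuous_on UNIV (\<lambda>Q :: real^'k^'k. trace Q)"
    unfolding trace_def by (intro continuous_intros)
  show ?thesis
    unfolding continuous_on_sequentially
  proof (intro allI ballI impI)
    fix X and Q :: "real^'k^'k"
    assume Q: "Q \<in> {Q. psd Q}" and X: "(\<forall>n. X n \<in> {Q. psd Q}) \<and> X \<longlonglongrightarrow> Q"
    then have "(\<lambda>n. trace (X n)) \<longlonglongrightarrow> trace Q"
      by (intro continuous_on_tendsto_compose[OF cont_trace]) auto
    then have "bounded (range (\<lambda>n. trace (X n)))"
      by (intro convergent_imp_bounded)
    then obtain b where b: "\<And>n. \<bar>trace (X n)\<bar> \<le> b"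
      unfolding bounded_iff by auto
    define c where "c = max b (trace Q)"
    have "\<forall>n. X n \<in> {Q. psd Q \<and> trace Q \<le> c}" "Q \<in> {Q. psd Q \<and> trace Q \<le> c}"
      using X Q b by (auto simp: c_def abs_le_iff max_def intro: order_trans)
    then show "(psd_sqrt \<circ> X) \<longlonglongrightarrow> psd_sqrt Q"
      using bounded_trace[of c] X unfolding continuous_on_sequentially by blast
  qed
qed

lemma power2_norm_matrix_diff:
  fixes A B :: "real^'n^'m"
  shows "(norm (A - B))\<^sup>2 = (norm A)\<^sup>2 + (norm B)\<^sup>2 - 2 * trace (transpose A ** B)"
proof -
  have "A \<bullet> B = trace (transpose A ** B)"
    by (simp add: trace_def inner_vec_def matrix_matrix_mult_def transpose_def) (rule sum.swap)
  then show ?thesis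
    by (simp add: power2_norm_eq_inner inner_diff_left inner_diff_right inner_commute)
qed

lemma norm_mult_orthogonal_matrix:
  fixes B :: "real^'n^'m"
  assumes "orthogonal_matrix U"
  shows "norm (B ** U) = norm B"
proof -
  have "(norm (B ** U))\<^sup>2 = trace ((transpose U ** (transpose B ** B)) ** U)"
    by (simp add: power2_norm_matrix matrix_transpose_mul matrix_mul_assoc)
  also have "\<dots> = trace ((U ** transpose U) ** (transpose B ** B))"
    by (subst trace_mul_sym) (simp add: matrix_mul_assoc)
  also have "\<dots> = (norm B)\<^sup>2"
    using assms by (simp add: orthogonal_matrix_def power2_norm_matrix)
  finally show ?thesis by simp
qed

text \<open>Write \<open>A\<close> and \<open>B\<close> for the square roots of the two covariances.  For orthogonal \<open>U\<close>, the matrix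
  term on the right is \<open>tr Q\<^sub>1 + tr Q\<^sub>2 - 2 tr (A B U)\<close>.  When \<open>A B U\<close> is the polar factor of
  \<open>A B\<close>, it is the square root of \<open>A B (A B)\<^sup>T = A Q\<^sub>2 A\<close>, which is the matrix in the
  Bures-Wasserstein formula.\<close>

lemma bw_dist_sq_attained:
  assumes "psd Q1" "psd Q2"
  obtains U where "orthogonal_matrix U"
    "bw_dist_sq (m1, Q1) (m2, Q2) = (norm (m1 - m2))\<^sup>2 + (norm (psd_sqrt Q1 - psd_sqrt Q2 ** U))\<^sup>2"
proof -
  define A where "A = psd_sqrt Q1"
  define B where "B = psd_sqrt Q2"
  have sym: "transpose A = A" "transpose B = B"
    using assms by (simp_all add: A_def B_def psd_transpose psd_psd_sqrt)
  have BB: "B ** B = Q2"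
    using assms by (simp add: B_def psd_sqrt_mult_self)
  obtain U where U: "orthogonal_matrix U" and P: "psd ((A ** B) ** U)"
    by (rule polar_decomposition)
  have "((A ** B) ** U) ** ((A ** B) ** U) = A ** Q2 ** A"
    by (subst polar_square[OF U P]) (simp add: matrix_transpose_mul sym BB[symmetric] matrix_mul_assoc)
  then have "psd_sqrt (A ** Q2 ** A) = A ** B ** U"
    using psd_sqrt_unique[OF P] by simp
  moreover have "(norm (A - B ** U))\<^sup>2 = trace Q1 + trace Q2 - 2 * trace (A ** B ** U)"
    using assms by (simp add: power2_norm_matrix_diff norm_mult_orthogonal_matrix[OF U] sym
        matrix_mul_assoc) (simp add: A_def B_def power2_norm_psd_sqrt)
  moreover have "trace (2 *\<^sub>R M) = 2 * trace M" for M :: "real^'a^'a"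
    by (simp add: trace_def sum_distrib_left)
  ultimately have "bw_dist_sq (m1, Q1) (m2, Q2) = (norm (m1 - m2))\<^sup>2 + (norm (A - B ** U))\<^sup>2"
    by (simp add: bw_dist_sq_def A_def[symmetric] trace_add trace_sub)
  with U show thesis
    unfolding A_def B_def by (rule that)
qed

section \<open>Rotation invariance and second moments of the standard Gaussian\<close>

lemma nn_integral_lborel_translate:
  fixes f :: "'a::euclidean_space \<Rightarrow> ennreal"
  assumes [measurable]: "f \<in> borel_measurable borel"
  shows "(\<integral>\<^sup>+x. f (c + x) \<partial>lborel) = (\<integral>\<^sup>+x. f x \<partial>lborel)"
proof -
  have "(\<integral>\<^sup>+x. f x \<partial>distr lborel borel ((+) c)) = (\<integral>\<^sup>+x. f (c + x) \<partial>lborel)"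
    by (simp add: nn_integral_distr)
  then show ?thesis by (simp add: lborel_distr_plus)
qed

text \<open>Uniqueness of translation-invariant measures, in the shortest form: the image of Lebesgue measure
  under \<open>U\<close> is translation invariant, and integrating \<open>f (U x) h (y - U x)\<close> over \<open>x\<close> and \<open>y\<close> in
  both orders, where \<open>h\<close> is the indicator of the unit ball, gives
  \<open>\<integral>h \<cdot> \<integral>f \<circ> U = \<integral>h \<cdot> \<integral>f\<close>.  The ball is used since it is symmetric under \<open>U\<close> and \<open>- U\<close> and has
  finite positive volume.\<close>

lemma nn_integral_lborel_orthogonal:
  fixes f :: "'a::euclidean_space \<Rightarrow> ennreal"
    and U :: "'a \<Rightarrow> 'a"
  assumes [measurable]: "f \<in> borel_measurable borel" and U: "orthogonal_transformation U"
  shows "(\<integral>\<^sup>+x. f (U x) \<partial>lborel) = (\<integral>\<^sup>+x. f x \<partial>lborel)"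
proof -
  define h :: "'a \<Rightarrow> ennreal" where "h = indicator (ball 0 1)"
  have [measurable]: "h \<in> borel_measurable borel" by (simp add: h_def borel_measurable_indicator)
  have "linear U" using U by (rule orthogonal_transformation_linear)
  then have [measurable]: "U \<in> borel_measurable borel"
    by (intro borel_measurable_continuous_onI linear_continuous_on linear_conv_bounded_linear[THEN iffD1])
  have "surj U" using U by (rule orthogonal_transformation_surj)
  have h_U: "h (- U x) = h x" for x
    using orthogonal_transformation_norm[OF U, of x] by (simp add: h_def indicator_def)
  have shift: "(\<integral>\<^sup>+x. f (U x) * h (y - U x) \<partial>lborel) = (\<integral>\<^sup>+x. f (y + U x) * h x \<partial>lborel)" for y
  proof -
    obtain c where c: "U c = y"
      using \<open>surj U\<close> by (metis surj_def)
    have "(\<integral>\<^sup>+x. f (U x) * h (y - U x) \<partial>lborel)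
        = (\<integral>\<^sup>+x. f (U (c + x)) * h (y - U (c + x)) \<partial>lborel)"
      by (rule nn_integral_lborel_translate[symmetric]) measurable
    then show ?thesis
      by (simp add: linear_add[OF \<open>linear U\<close>] c h_U)
  qed
  have "(\<integral>\<^sup>+x. f (U x) \<partial>lborel) * (\<integral>\<^sup>+y. h y \<partial>lborel)
      = (\<integral>\<^sup>+x. \<integral>\<^sup>+y. f (U x) * h y \<partial>lborel \<partial>lborel)"
    by (simp add: nn_integral_cmult nn_integral_multc)
  also have "\<dots> = (\<integral>\<^sup>+x. \<integral>\<^sup>+y. f (U x) * h (y - U x) \<partial>lborel \<partial>lborel)"
  proof (rule nn_integral_cong)
    fix x
    have "(\<integral>\<^sup>+y. f (U x) * h y \<partial>lborel) = (\<integral>\<^sup>+y. f (U x) * h (- U x + y) \<partial>lborel)"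
      by (rule nn_integral_lborel_translate[symmetric]) measurable
    then show "(\<integral>\<^sup>+y. f (U x) * h y \<partial>lborel) = (\<integral>\<^sup>+y. f (U x) * h (y - U x) \<partial>lborel)"
      by simp
  qed
  also have "\<dots> = (\<integral>\<^sup>+y. \<integral>\<^sup>+x. f (U x) * h (y - U x) \<partial>lborel \<partial>lborel)"
    by (rule lborel_pair.Fubini') measurable
  also have "\<dots> = (\<integral>\<^sup>+y. \<integral>\<^sup>+x. f (y + U x) * h x \<partial>lborel \<partial>lborel)"
    by (simp add: shift)
  also have "\<dots> = (\<integral>\<^sup>+x. \<integral>\<^sup>+y. f (y + U x) * h x \<partial>lborel \<partial>lborel)"
    by (rule lborel_pair.Fubini') measurable
  also have "\<dots> = (\<integral>\<^sup>+x. (\<integral>\<^sup>+y. f y \<partial>lborel) * h x \<partial>lborel)"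
  proof (rule nn_integral_cong)
    fix x
    have "(\<integral>\<^sup>+y. f (U x + y) \<partial>lborel) = (\<integral>\<^sup>+y. f y \<partial>lborel)"
      by (rule nn_integral_lborel_translate) measurable
    then show "(\<integral>\<^sup>+y. f (y + U x) * h x \<partial>lborel) = (\<integral>\<^sup>+y. f y \<partial>lborel) * h x"
      by (simp add: nn_integral_multc add.commute)
  qed
  also have "\<dots> = (\<integral>\<^sup>+y. f y \<partial>lborel) * (\<integral>\<^sup>+x. h x \<partial>lborel)"
    by (simp add: nn_integral_cmult)
  finally have "(\<integral>\<^sup>+y. h y \<partial>lborel) * (\<integral>\<^sup>+x. f (U x) \<partial>lborel)
      = (\<integral>\<^sup>+y. h y \<partial>lborel) * (\<integral>\<^sup>+x. f x \<partial>lborel)"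
    by (simp add: mult.commute)
  moreover have "(\<integral>\<^sup>+y. h y \<partial>lborel) = ennreal (unit_ball_vol (DIM('a)))"
    by (simp add: h_def emeasure_ball)
  moreover have "unit_ball_vol (real DIM('a)) \<noteq> 0"
    by (rule less_imp_neq[OF unit_ball_vol_pos, symmetric]) simp
  ultimately show ?thesis
    by (simp add: ennreal_mult_cancel_left)
qed

lemma nn_integral_lborel_prod_cart:
  fixes f :: "'k::finite \<Rightarrow> real \<Rightarrow> ennreal"
  assumes [measurable]: "\<And>i. f i \<in> borel_measurable borel"
  shows "(\<integral>\<^sup>+x. (\<Prod>i\<in>UNIV. f i ((x :: real^'k) $ i)) \<partial>lborel) = (\<Prod>i\<in>UNIV. \<integral>\<^sup>+t. f i t \<partial>lborel)"
proof -
  define ix :: "real^'k \<Rightarrow> 'k" where "ix b = (THE i. b = axis i 1)" for b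
  have ix: "ix (axis i 1) = i" for i
    by (auto simp: ix_def axis_eq_axis)
  have Basis: "(Basis :: (real^'k) set) = range (\<lambda>i. axis i 1)"
    by (auto simp: Basis_vec_def)
  have inj: "inj (\<lambda>i. axis i 1 :: real^'k)"
    by (auto simp: inj_on_def axis_eq_axis)
  have reindex: "(\<Prod>b\<in>Basis. g b) = (\<Prod>i\<in>UNIV. g (axis i 1))" for g :: "real^'k \<Rightarrow> ennreal"
    unfolding Basis by (subst prod.reindex[OF inj]) (simp add: comp_def)
  have "(\<integral>\<^sup>+x. (\<Prod>b\<in>Basis. f (ix b) ((x :: real^'k) \<bullet> b)) \<partial>lborel)
      = (\<Prod>b\<in>(Basis :: (real^'k) set). \<integral>\<^sup>+t. f (ix b) t \<partial>lborel)"
    by (rule nn_integral_lborel_prod) auto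
  then show ?thesis
    by (simp add: reindex ix inner_axis)
qed

lemma sets_std_gaussian [simp, measurable_cong]: "sets std_gaussian = sets borel"
  by (simp add: std_gaussian_def)

lemma space_std_gaussian [simp]: "space std_gaussian = UNIV"
  by (simp add: std_gaussian_def)

lemma power2_norm_vec: "(norm x)\<^sup>2 = (\<Sum>i\<in>UNIV. (x $ i)\<^sup>2)" for x :: "real^'k"
  unfolding power2_norm_eq_inner inner_vec_def by (simp add: power2_eq_square)

lemma std_gaussian_radial:
  fixes x :: "real^'k"
  shows "(\<Prod>i\<in>UNIV. std_normal_density (x $ i)) = (1 / sqrt (2 * pi)) ^ CARD('k) * exp (- (norm x)\<^sup>2 / 2)"
proof -
  show ?thesis
    by (simp add: power2_norm_vec std_normal_density_def prod_dividef exp_sum[symmetric] sum_negf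
        sum_divide_distrib power_divide)
qed

lemma nn_integral_std_gaussian:
  fixes f :: "real^'k \<Rightarrow> ennreal"
  assumes "f \<in> borel_measurable borel"
  shows "(\<integral>\<^sup>+x. f x \<partial>std_gaussian)
    = (\<integral>\<^sup>+x. ennreal (\<Prod>i\<in>UNIV. std_normal_density (x $ i)) * f x \<partial>lborel)"
  unfolding std_gaussian_def using assms by (subst nn_integral_density) auto

lemma nn_integral_std_gaussian_orthogonal:
  fixes f :: "real^'k \<Rightarrow> ennreal"
  assumes f [measurable]: "f \<in> borel_measurable borel" and U: "orthogonal_matrix U"
  shows "(\<integral>\<^sup>+x. f (U *v x) \<partial>std_gaussian) = (\<integral>\<^sup>+x. f x \<partial>std_gaussian)"
proof -
  have T: "orthogonal_transformation ((*v) U)"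
    using U by (simp add: orthogonal_transformation_matrix)
  have [measurable]: "(*v) U \<in> borel_measurable borel"
    by (intro borel_measurable_continuous_onI continuous_intros)
  have "(\<integral>\<^sup>+x. f (U *v x) \<partial>std_gaussian)
      = (\<integral>\<^sup>+x. ennreal (\<Prod>i\<in>UNIV. std_normal_density ((U *v x) $ i)) * f (U *v x) \<partial>lborel)"
    by (simp add: nn_integral_std_gaussian std_gaussian_radial orthogonal_transformation_norm[OF T])
  also have "\<dots> = (\<integral>\<^sup>+x. f x \<partial>std_gaussian)"
    by (subst nn_integral_lborel_orthogonal[OF _ T]) (simp_all add: nn_integral_std_gaussian)
  finally show ?thesis .
qed

lemma nn_integral_std_normal:
  "(\<integral>\<^sup>+t. ennreal (std_normal_density t) \<partial>lborel) = 1"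
  "(\<integral>\<^sup>+t. ennreal (std_normal_density t * t\<^sup>2) \<partial>lborel) = 1"
  using std_normal_moment_even[of 0] std_normal_moment_even[of 1]
  by (subst nn_integral_eq_integral; simp add: has_bochner_integral_iff)+

lemma prob_space_std_gaussian: "prob_space (std_gaussian :: (real^'k) measure)"
proof
  have "emeasure (std_gaussian :: (real^'k) measure) (space std_gaussian)
      = (\<integral>\<^sup>+x. ennreal (\<Prod>i\<in>UNIV. std_normal_density ((x :: real^'k) $ i)) \<partial>lborel)"
    using nn_integral_std_gaussian[of "\<lambda>_. 1"] by simp
  also have "\<dots> = (\<integral>\<^sup>+x. (\<Prod>i\<in>UNIV. ennreal (std_normal_density ((x :: real^'k) $ i))) \<partial>lborel)"
    by (simp add: prod_ennreal)
  also have "\<dots> = 1"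
    by (subst nn_integral_lborel_prod_cart) (simp_all add: nn_integral_std_normal)
  finally show "emeasure (std_gaussian :: (real^'k) measure) (space std_gaussian) = 1" .
qed

interpretation std_gaussian: prob_space std_gaussian
  by (rule prob_space_std_gaussian)

lemma nn_integral_std_gaussian_coordinate:
  "(\<integral>\<^sup>+x. ennreal ((x $ i)\<^sup>2) \<partial>(std_gaussian :: (real^'k) measure)) = 1"
proof -
  have "(\<integral>\<^sup>+x. ennreal ((x $ i)\<^sup>2) \<partial>(std_gaussian :: (real^'k) measure))
      = (\<integral>\<^sup>+x. (\<Prod>j\<in>UNIV. ennreal (std_normal_density ((x :: real^'k) $ j) * (if j = i then (x $ j)\<^sup>2 else 1)))
          \<partial>lborel)"
    by (subst nn_integral_std_gaussian)
      (simp_all add: prod_ennreal prod.distrib ennreal_mult prod_nonneg)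
  also have "\<dots> = (\<Prod>j\<in>UNIV. \<integral>\<^sup>+t. ennreal (std_normal_density t * (if j = i then t\<^sup>2 else 1)) \<partial>lborel)"
    by (rule nn_integral_lborel_prod_cart) simp
  also have "\<dots> = 1"
  proof (intro prod.neutral ballI)
    show "(\<integral>\<^sup>+t. ennreal (std_normal_density t * (if j = i then t\<^sup>2 else 1)) \<partial>lborel) = 1" for j
      by (cases "j = i") (simp_all add: nn_integral_std_normal)
  qed
  finally show ?thesis .
qed

text \<open>Rotate \<open>c\<close> to a multiple of a coordinate vector.\<close>

lemma nn_integral_std_gaussian_inner:
  fixes c :: "real^'k"
  shows "(\<integral>\<^sup>+x. ennreal ((c \<bullet> x)\<^sup>2) \<partial>std_gaussian) = ennreal ((norm c)\<^sup>2)"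
proof -
  define i :: 'k where "i = undefined"
  have "norm (norm c *\<^sub>R axis i 1 :: real^'k) = norm c" by simp
  then obtain f :: "real^'k \<Rightarrow> real^'k" where f: "orthogonal_transformation f"
    and fc: "f (norm c *\<^sub>R axis i 1) = c"
    using orthogonal_transformation_exists by blast
  define U where "U = matrix f"
  have U: "orthogonal_matrix U" and Uf: "U *v x = f x" for x
    using f by (auto simp: U_def orthogonal_transformation_matrix matrix_works)
  have "c \<bullet> (U *v x) = norm c * x $ i" for x
  proof -
    have "c \<bullet> (U *v x) = f (norm c *\<^sub>R axis i 1) \<bullet> f x"
      by (simp add: fc Uf)
    also have "\<dots> = (norm c *\<^sub>R axis i 1) \<bullet> x"
      using f by (simp add: orthogonal_transformation_def)
    finally show ?thesis
      by (simp add: inner_axis')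
  qed
  then have "(\<integral>\<^sup>+x. ennreal ((c \<bullet> (U *v x))\<^sup>2) \<partial>std_gaussian)
      = (\<integral>\<^sup>+x. ennreal ((norm c)\<^sup>2) * ennreal ((x $ i)\<^sup>2) \<partial>std_gaussian)"
    by (simp add: power_mult_distrib ennreal_mult)
  also have "\<dots> = ennreal ((norm c)\<^sup>2)"
    by (subst nn_integral_cmult) (simp_all add: nn_integral_std_gaussian_coordinate)
  finally show ?thesis
    by (subst (asm) nn_integral_std_gaussian_orthogonal[OF _ U]) auto
qed

lemma nn_integral_std_gaussian_linear:
  fixes C :: "real^'k^'m"
  shows "(\<integral>\<^sup>+x. ennreal ((norm (C *v x))\<^sup>2) \<partial>std_gaussian) = ennreal ((norm C)\<^sup>2)"
proof -
  have "(norm (C *v x))\<^sup>2 = (\<Sum>i\<in>UNIV. (C $ i \<bullet> x)\<^sup>2)" for x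
    by (simp add: power2_norm_vec matrix_vector_mul_component)
  then have "(\<integral>\<^sup>+x. ennreal ((norm (C *v x))\<^sup>2) \<partial>std_gaussian)
      = (\<Sum>i\<in>UNIV. \<integral>\<^sup>+x. ennreal ((C $ i \<bullet> x)\<^sup>2) \<partial>std_gaussian)"
    by (simp add: sum_ennreal[symmetric] nn_integral_sum del: sum_ennreal)
  also have "\<dots> = ennreal ((norm C)\<^sup>2)"
    by (simp add: nn_integral_std_gaussian_inner sum_nonneg)
      (simp add: power2_norm_eq_inner inner_vec_def[of C])
  finally show ?thesis .
qed

text \<open>Averaging over \<open>x\<close> and \<open>- x\<close> removes the cross term by the parallelogram law, so only integrals of
  nonnegative functions occur and no integrability has to be shown.\<close>

lemma nn_integral_std_gaussian_affine:
  fixes C :: "real^'k^'m"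
  shows "(\<integral>\<^sup>+x. ennreal ((norm (m + C *v x))\<^sup>2) \<partial>std_gaussian) = ennreal ((norm m)\<^sup>2 + (norm C)\<^sup>2)"
proof -
  define I where "I = (\<integral>\<^sup>+x. ennreal ((norm (m + C *v x))\<^sup>2) \<partial>std_gaussian)"
  have [measurable]: "(*v) C \<in> borel_measurable borel"
    by (intro borel_measurable_continuous_onI continuous_intros)
  have neg_mult: "(- mat 1) *v x = - x" for x :: "real^'k"
    using matrix_vector_mult_diff_rdistrib[of 0 "mat 1" x] by simp
  have "transpose (- mat 1 :: real^'k^'k) = - mat 1"
    by (auto simp: vec_eq_iff transpose_def mat_def)
  then have neg: "orthogonal_matrix (- mat 1 :: real^'k^'k)"
    by (simp add: orthogonal_matrix matrix_eq matrix_vector_mul_assoc[symmetric] neg_mult)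
  have "(\<integral>\<^sup>+x. ennreal ((norm (m - C *v x))\<^sup>2) \<partial>std_gaussian) = I"
    using nn_integral_std_gaussian_orthogonal[OF _ neg, of "\<lambda>x. ennreal ((norm (m + C *v x))\<^sup>2)"]
    by (simp add: I_def neg_mult linear_neg)
  then have "2 * I = (\<integral>\<^sup>+x. ennreal ((norm (m + C *v x))\<^sup>2) + ennreal ((norm (m - C *v x))\<^sup>2) \<partial>std_gaussian)"
    by (subst nn_integral_add) (simp_all add: I_def mult_2)
  also have "\<dots> = (\<integral>\<^sup>+x. ennreal (2 * (norm m)\<^sup>2) + 2 * ennreal ((norm (C *v x))\<^sup>2) \<partial>std_gaussian)"
  proof (rule nn_integral_cong)
    fix x
    have "(norm (m + C *v x))\<^sup>2 + (norm (m - C *v x))\<^sup>2 = 2 * (norm m)\<^sup>2 + 2 * (norm (C *v x))\<^sup>2"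
      by (simp add: power2_norm_eq_inner inner_simps)
    then show "ennreal ((norm (m + C *v x))\<^sup>2) + ennreal ((norm (m - C *v x))\<^sup>2)
        = ennreal (2 * (norm m)\<^sup>2) + 2 * ennreal ((norm (C *v x))\<^sup>2)"
      by (simp add: ennreal_plus[symmetric] ennreal_mult del: ennreal_plus) (simp add: ennreal_mult)
  qed
  also have "\<dots> = ennreal (2 * (norm m)\<^sup>2) + 2 * ennreal ((norm C)\<^sup>2)"
    by (subst nn_integral_add)
      (simp_all add: nn_integral_cmult nn_integral_std_gaussian_linear std_gaussian.emeasure_space_1[simplified])
  also have "\<dots> = 2 * ennreal ((norm m)\<^sup>2 + (norm C)\<^sup>2)"
    by (simp add: ennreal_mult distrib_left)
  finally show ?thesis
    unfolding ennreal_mult_cancel_left I_def by simp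
qed

section \<open>Gaussian mixtures as images of product measures\<close>

lemma borel_measurable_fst_comp [measurable (raw)]:
  fixes f :: "'a \<Rightarrow> 'b::topological_space \<times> 'c::topological_space"
  shows "f \<in> borel_measurable M \<Longrightarrow> (\<lambda>x. fst (f x)) \<in> borel_measurable M"
  by (rule measurable_compose[OF _ borel_measurable_continuous_onI]) (auto intro: continuous_intros)

lemma borel_measurable_snd_comp [measurable (raw)]:
  fixes f :: "'a \<Rightarrow> 'b::topological_space \<times> 'c::topological_space"
  shows "f \<in> borel_measurable M \<Longrightarrow> (\<lambda>x. snd (f x)) \<in> borel_measurable M"
  by (rule measurable_compose[OF _ borel_measurable_continuous_onI]) (auto intro: continuous_intros)

lemma borel_measurable_matrix_vector_mult [measurable (raw)]:
  fixes f :: "'a \<Rightarrow> real^'k^'m"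
  assumes "f \<in> borel_measurable M" "g \<in> borel_measurable M"
  shows "(\<lambda>x. f x *v g x) \<in> borel_measurable M"
  using assms
  by (rule borel_measurable_continuous_Pair)
    (unfold matrix_vector_mult_def, intro continuous_intros)

lemma borel_measurable_matrix_mult [measurable (raw)]:
  fixes f :: "'a \<Rightarrow> real^'k^'m" and g :: "'a \<Rightarrow> real^'l^'k"
  assumes "f \<in> borel_measurable M" "g \<in> borel_measurable M"
  shows "(\<lambda>x. f x ** g x) \<in> borel_measurable M"
  using assms
  by (rule borel_measurable_continuous_Pair)
    (unfold matrix_matrix_mult_def, intro continuous_intros)

lemma borel_measurable_trace [measurable (raw)]:
  fixes f :: "'a \<Rightarrow> real^'k^'k"
  assumes [measurable]: "f \<in> borel_measurable M"
  shows "(\<lambda>x. trace (f x)) \<in> borel_measurable M"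
  unfolding trace_def
  by (intro borel_measurable_sum measurable_compose[OF assms] borel_measurable_continuous_onI
      continuous_intros)

lemma borel_measurable_psd_sqrt:
  fixes f :: "'a \<Rightarrow> real^'k^'k"
  assumes "f \<in> borel_measurable M" "\<And>x. x \<in> space M \<Longrightarrow> psd (f x)"
  shows "(\<lambda>x. psd_sqrt (f x)) \<in> borel_measurable M"
proof -
  have "f \<in> M \<rightarrow>\<^sub>M restrict_space borel {Q. psd Q}"
    using assms by (intro measurable_restrict_space2) auto
  then show ?thesis
    by (rule measurable_compose)
      (rule borel_measurable_continuous_on_restrict[OF continuous_on_psd_sqrt])
qed

lemma continuous_on_split_vec: "continuous_on UNIV split_vec"
  unfolding split_vec_def by (intro continuous_intros)

lemma continuous_on_join_vec: "continuous_on UNIV (join_vec :: (real^'n) \<times> (real^'n) \<Rightarrow> _)"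
proof -
  have "continuous_on UNIV (\<lambda>p :: (real^'n) \<times> (real^'n). case i of Inl j \<Rightarrow> fst p $ j | Inr j \<Rightarrow> snd p $ j)"
    for i
    by (cases i) (auto intro!: continuous_intros)
  then show ?thesis
    unfolding join_vec_def by (intro continuous_intros)
qed

lemma borel_measurable_split_vec [measurable]: "split_vec \<in> borel_measurable borel"
  by (rule borel_measurable_continuous_onI[OF continuous_on_split_vec])

lemma borel_measurable_join_vec [measurable]: "join_vec \<in> borel_measurable borel"
  by (rule borel_measurable_continuous_onI[OF continuous_on_join_vec])

lemma power2_norm_Pair: "(norm p)\<^sup>2 = (norm (fst p))\<^sup>2 + (norm (snd p))\<^sup>2"
  by (cases p) (simp add: norm_Pair)

lemma norm_split_vec: "norm (split_vec v) = norm v"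
proof -
  have "(norm (split_vec v))\<^sup>2 = (norm v)\<^sup>2"
    unfolding power2_norm_Pair power2_norm_vec UNIV_Plus_UNIV[symmetric]
    by (subst sum.Plus) (simp_all add: split_vec_def)
  then show ?thesis by simp
qed

lemma norm_join_vec: "norm (join_vec p) = norm p"
  by (metis norm_split_vec split_vec_join_vec)

lemma sets_gaussian [simp]: "sets (gaussian s) = sets borel"
  by (simp add: gaussian_def split_beta)

text \<open>For zero covariance the Gaussian is a point mass; this degenerate case carries the
  characterisation of Gaussian mixtures and the comparison \<open>W2_prm \<le> W2_mix\<close>.\<close>

lemma gaussian_0 [simp]: "gaussian (m, 0) = return borel m"
  unfolding gaussian_def by (simp add: std_gaussian.distr_const)

lemma emeasure_distr_indicator:
  assumes "f \<in> M \<rightarrow>\<^sub>M N" "A \<in> sets N"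
  shows "emeasure (distr M N f) A = (\<integral>\<^sup>+x. indicator A (f x) \<partial>M)"
proof -
  have "emeasure (distr M N f) A = (\<integral>\<^sup>+y. indicator A y \<partial>distr M N f)"
    using assms by simp
  also have "\<dots> = (\<integral>\<^sup>+x. indicator A (f x) \<partial>M)"
    using assms by (intro nn_integral_distr) auto
  finally show ?thesis .
qed

text \<open>This is why a rotation may be inserted into the second component of a coupling without changing its
  marginal.\<close>

lemma gaussian_orthogonal:
  assumes "orthogonal_matrix U"
  shows "distr std_gaussian borel (\<lambda>x. m + (psd_sqrt Q ** U) *v x) = gaussian (m, Q)"
proof -
  have *: "emeasure (distr std_gaussian borel (\<lambda>x. m + C *v x)) A
      = (\<integral>\<^sup>+x. indicator A (m + C *v x) \<partial>std_gaussian)" if "A \<in> sets borel" for A and C :: "real^'a^'a"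
    using that by (subst emeasure_distr_indicator) simp_all
  show ?thesis
  proof (rule measure_eqI)
    fix A assume "A \<in> sets (distr std_gaussian borel (\<lambda>x. m + (psd_sqrt Q ** U) *v x))"
    then have [measurable]: "A \<in> sets borel" by simp
    show "emeasure (distr std_gaussian borel (\<lambda>x. m + (psd_sqrt Q ** U) *v x)) A = emeasure (gaussian (m, Q)) A"
      using nn_integral_std_gaussian_orthogonal[OF _ assms, of "\<lambda>x. indicator A (m + psd_sqrt Q *v x)"]
      by (simp add: gaussian_def * matrix_vector_mul_assoc)
  qed simp
qed

lemma borel_measurable_gaussian_sample:
  fixes w :: "'a \<Rightarrow> (real^'k) \<times> (real^'k^'k)"
  assumes [measurable]: "w \<in> borel_measurable M" and "\<And>z. z \<in> space M \<Longrightarrow> psd (snd (w z))"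
  shows "(\<lambda>p. fst (w (fst p)) + psd_sqrt (snd (w (fst p))) *v snd p) \<in> borel_measurable (M \<Otimes>\<^sub>M std_gaussian)"
proof -
  have [measurable]: "(\<lambda>z. psd_sqrt (snd (w z))) \<in> borel_measurable M"
    using assms(2) by (intro borel_measurable_psd_sqrt) measurable
  show ?thesis by measurable
qed

lemma emeasure_distr_pair_std_gaussian:
  assumes [measurable]: "F \<in> borel_measurable (M \<Otimes>\<^sub>M std_gaussian)" "A \<in> sets borel"
  shows "emeasure (distr (M \<Otimes>\<^sub>M std_gaussian) borel F) A
    = (\<integral>\<^sup>+z. emeasure (distr std_gaussian borel (\<lambda>x. F (z, x))) A \<partial>M)"
proof -
  have "emeasure (distr (M \<Otimes>\<^sub>M std_gaussian) borel F) A
      = (\<integral>\<^sup>+p. indicator A (F p) \<partial>(M \<Otimes>\<^sub>M std_gaussian))"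
    by (subst emeasure_distr_indicator) simp_all
  also have "\<dots> = (\<integral>\<^sup>+z. \<integral>\<^sup>+x. indicator A (F (z, x)) \<partial>std_gaussian \<partial>M)"
    by (subst std_gaussian.nn_integral_fst[symmetric]) simp_all
  also have "\<dots> = (\<integral>\<^sup>+z. emeasure (distr std_gaussian borel (\<lambda>x. F (z, x))) A \<partial>M)"
  proof (rule nn_integral_cong)
    fix z assume [measurable]: "z \<in> space M"
    show "(\<integral>\<^sup>+x. indicator A (F (z, x)) \<partial>std_gaussian) = emeasure (distr std_gaussian borel (\<lambda>x. F (z, x))) A"
      by (subst emeasure_distr_indicator) simp_all
  qed
  finally show ?thesis .
qed

lemma nn_integral_distr_pair_std_gaussian:
  assumes [measurable]: "F \<in> borel_measurable (M \<Otimes>\<^sub>M std_gaussian)" "f \<in> borel_measurable borel"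
  shows "(\<integral>\<^sup>+y. f y \<partial>distr (M \<Otimes>\<^sub>M std_gaussian) borel F) = (\<integral>\<^sup>+z. \<integral>\<^sup>+x. f (F (z, x)) \<partial>std_gaussian \<partial>M)"
  by (subst nn_integral_distr) (simp_all add: std_gaussian.nn_integral_fst[symmetric])

text \<open>Without this, the change of variables in integrals against mixing measures would not be available.\<close>

lemma borel_measurable_emeasure_gaussian:
  fixes w :: "'a \<Rightarrow> (real^'k) \<times> (real^'k^'k)"
  assumes "w \<in> borel_measurable M" and "\<And>z. z \<in> space M \<Longrightarrow> psd (snd (w z))"
    and [measurable]: "A \<in> sets borel"
  shows "(\<lambda>z. emeasure (gaussian (w z)) A) \<in> borel_measurable M"
proof -
  note [measurable] = borel_measurable_gaussian_sample[OF assms(1,2)]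
  have "emeasure (gaussian (w z)) A
      = (\<integral>\<^sup>+x. indicator A (fst (w z) + psd_sqrt (snd (w z)) *v x) \<partial>std_gaussian)" for z
    unfolding gaussian_def split_beta
    by (subst emeasure_distr_indicator) simp_all
  moreover have "(\<lambda>z. \<integral>\<^sup>+x. indicator A (fst (w z) + psd_sqrt (snd (w z)) *v x) \<partial>std_gaussian)
      \<in> borel_measurable M"
    using std_gaussian.borel_measurable_nn_integral_fst[of
        "\<lambda>p. indicator A (fst (w (fst p)) + psd_sqrt (snd (w (fst p))) *v snd p)" M]
    by simp
  ultimately show ?thesis by simp
qed

lemma gaussian_pair_distr:
  "gaussian_pair z = distr std_gaussian borel
     (\<lambda>x. split_vec (join_vec (fst z) + psd_sqrt (snd z) *v x))"
  unfolding gaussian_pair_def gaussian_def split_beta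
  by (simp add: distr_distr comp_def)

text \<open>The mixing measure may sit on point masses, so every law is a Gaussian mixture, and the only content
  of the class is the moment condition: the second moment of the mixture is the integral of
  \<open>\<parallel>m\<parallel>\<^sup>2 + tr Q\<close>.\<close>

lemma GM2_iff:
  "\<nu> \<in> GM2 \<longleftrightarrow> sets \<nu> = sets borel \<and> prob_space \<nu> \<and> (\<integral>\<^sup>+y. ennreal ((norm y)\<^sup>2) \<partial>\<nu>) < \<infinity>"
  for \<nu> :: "((real^'n) \<times> (real^'n)) measure"
proof (intro iffI conjI; (elim conjE)?)
  assume "\<nu> \<in> GM2"
  then obtain \<Lambda> :: "(((real^'n) \<times> (real^'n)) \<times> (real^('n + 'n)^('n + 'n))) measure"
    where sets: "sets \<nu> = sets borel" and "prob_space \<nu>"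
      and \<Lambda>: "sets \<Lambda> = sets (restrict_space borel Z_space)"
      and mix: "\<And>A. A \<in> sets borel \<Longrightarrow> emeasure \<nu> A = (\<integral>\<^sup>+z. emeasure (gaussian_pair z) A \<partial>\<Lambda>)"
      and fin: "(\<integral>\<^sup>+z. ennreal ((norm (fst z))\<^sup>2 + trace (snd z)) \<partial>\<Lambda>) < \<infinity>"
    unfolding GM2_def by blast
  show "sets \<nu> = sets borel" "prob_space \<nu>" by fact+
  note [measurable_cong] = \<Lambda>
  have space: "space \<Lambda> = Z_space"
    using sets_eq_imp_space_eq[OF \<Lambda>] by (simp add: space_restrict_space)
  have [measurable]: "(\<lambda>z. z) \<in> borel_measurable \<Lambda>"
    unfolding measurable_cong_sets[OF \<Lambda> refl] by (intro measurable_restrict_space1) simp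
  define w where "w = (\<lambda>z :: ((real^'n) \<times> (real^'n)) \<times> (real^('n + 'n)^('n + 'n)). (join_vec (fst z), snd z))"
  have psd: "psd (snd z)" if "z \<in> space \<Lambda>" for z
    using that by (auto simp: space Z_space_def)
  have "w \<in> borel_measurable \<Lambda>"
    unfolding w_def by measurable
  from borel_measurable_gaussian_sample[OF this] psd
  have "(\<lambda>p. join_vec (fst (fst p)) + psd_sqrt (snd (fst p)) *v snd p) \<in> borel_measurable (\<Lambda> \<Otimes>\<^sub>M std_gaussian)"
    by (simp add: w_def)
  then have F [measurable]: "(\<lambda>p. split_vec (join_vec (fst (fst p)) + psd_sqrt (snd (fst p)) *v snd p))
      \<in> borel_measurable (\<Lambda> \<Otimes>\<^sub>M std_gaussian)" (is "?F \<in> _")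
    by measurable
  have "\<nu> = distr (\<Lambda> \<Otimes>\<^sub>M std_gaussian) borel ?F"
    by (rule measure_eqI)
      (simp_all add: sets mix emeasure_distr_pair_std_gaussian[OF F] gaussian_pair_distr)
  then have "(\<integral>\<^sup>+y. ennreal ((norm y)\<^sup>2) \<partial>\<nu>)
      = (\<integral>\<^sup>+z. \<integral>\<^sup>+x. ennreal ((norm (join_vec (fst z) + psd_sqrt (snd z) *v x))\<^sup>2) \<partial>std_gaussian \<partial>\<Lambda>)"
    by (simp add: nn_integral_distr_pair_std_gaussian[OF F] norm_split_vec)
  also have "\<dots> = (\<integral>\<^sup>+z. ennreal ((norm (fst z))\<^sup>2 + trace (snd z)) \<partial>\<Lambda>)"
    by (intro nn_integral_cong)
      (simp add: nn_integral_std_gaussian_affine norm_join_vec power2_norm_psd_sqrt psd)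
  finally show "(\<integral>\<^sup>+y. ennreal ((norm y)\<^sup>2) \<partial>\<nu>) < \<infinity>"
    using fin by simp
next
  assume sets [measurable_cong]: "sets \<nu> = sets borel" and prob: "prob_space \<nu>"
    and fin: "(\<integral>\<^sup>+y. ennreal ((norm y)\<^sup>2) \<partial>\<nu>) < \<infinity>"
  define d where "d = (\<lambda>y :: (real^'n) \<times> (real^'n). (y, 0 :: real^('n + 'n)^('n + 'n)))"
  define \<Lambda> where "\<Lambda> = distr \<nu> (restrict_space borel Z_space) d"
  have d: "d \<in> \<nu> \<rightarrow>\<^sub>M restrict_space borel Z_space"
    unfolding d_def by (intro measurable_restrict_space2) (auto simp: Z_space_def psd_0)
  have [measurable]: "(\<lambda>z. z) \<in> borel_measurable (restrict_space borel Z_space)"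
    by (intro measurable_restrict_space1) simp
  have "emeasure \<nu> A = (\<integral>\<^sup>+z. emeasure (gaussian_pair z) A \<partial>\<Lambda>)" if A: "A \<in> sets borel" for A
  proof -
    have [measurable]: "split_vec -` A \<in> sets borel"
      using measurable_sets[OF borel_measurable_split_vec A] by simp
    have eq: "emeasure (gaussian_pair z) A = emeasure (gaussian (join_vec (fst z), snd z)) (split_vec -` A)" for z
      unfolding gaussian_pair_def split_beta using A
      by (subst emeasure_distr) (simp_all add: sets_eq_imp_space_eq[OF sets_gaussian]
          measurable_cong_sets[OF sets_gaussian refl])
    have "(\<lambda>z. emeasure (gaussian_pair z) A) \<in> borel_measurable (restrict_space borel Z_space)"
      unfolding eq
    proof (rule borel_measurable_emeasure_gaussian)
      show "(\<lambda>z. (join_vec (fst z), snd z)) \<in> borel_measurable (restrict_space borel Z_space)"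
        by measurable
    qed (auto simp: space_restrict_space Z_space_def)
    then have "(\<integral>\<^sup>+z. emeasure (gaussian_pair z) A \<partial>\<Lambda>) = (\<integral>\<^sup>+y. emeasure (gaussian_pair (d y)) A \<partial>\<nu>)"
      unfolding \<Lambda>_def by (intro nn_integral_distr d) simp
    also have "\<dots> = (\<integral>\<^sup>+y. indicator A y \<partial>\<nu>)"
      by (simp add: eq d_def split_vec_join_vec indicator_def)
    finally show ?thesis
      using A by (simp add: sets)
  qed
  moreover have "(\<integral>\<^sup>+z. ennreal ((norm (fst z))\<^sup>2 + trace (snd z)) \<partial>\<Lambda>) < \<infinity>"
    unfolding \<Lambda>_def using fin
    by (subst nn_integral_distr[OF d]) (simp_all add: d_def trace_0[simplified mat_0])
  moreover have "prob_space \<Lambda>"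
    unfolding \<Lambda>_def by (rule prob_space.prob_space_distr[OF prob d])
  ultimately show "\<nu> \<in> GM2"
    unfolding GM2_def using sets prob by (auto simp: \<Lambda>_def intro!: exI[of _ \<Lambda>])
qed

section \<open>The two inequalities\<close>

lemma bw_dist_sq_nonneg:
  assumes "psd (snd s)" "psd (snd t)"
  shows "0 \<le> bw_dist_sq s t"
proof -
  obtain U where "bw_dist_sq (fst s, snd s) (fst t, snd t)
      = (norm (fst s - fst t))\<^sup>2 + (norm (psd_sqrt (snd s) - psd_sqrt (snd t) ** U))\<^sup>2"
    by (rule bw_dist_sq_attained[OF assms])
  then show ?thesis by simp
qed

lemma borel_measurable_bw_dist_sq:
  fixes f g :: "'a \<Rightarrow> (real^'n) \<times> (real^'n^'n)"
  assumes [measurable]: "f \<in> borel_measurable M" "g \<in> borel_measurable M"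
    and psd: "\<And>x. x \<in> space M \<Longrightarrow> psd (snd (f x))" "\<And>x. x \<in> space M \<Longrightarrow> psd (snd (g x))"
  shows "(\<lambda>x. bw_dist_sq (f x) (g x)) \<in> borel_measurable M"
proof -
  have [measurable]: "(\<lambda>x. psd_sqrt (snd (f x))) \<in> borel_measurable M"
    by (intro borel_measurable_psd_sqrt psd) measurable
  have "psd (psd_sqrt (snd (f x)) ** snd (g x) ** psd_sqrt (snd (f x)))" if "x \<in> space M" for x
    using psd_congruence[OF psd(2)[OF that], of "psd_sqrt (snd (f x))"]
    by (simp add: psd_transpose psd_psd_sqrt psd(1)[OF that])
  then have [measurable]:
    "(\<lambda>x. psd_sqrt (psd_sqrt (snd (f x)) ** snd (g x) ** psd_sqrt (snd (f x)))) \<in> borel_measurable M"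
    by (intro borel_measurable_psd_sqrt) measurable
  show ?thesis
    unfolding bw_dist_sq_def split_beta by measurable
qed

lemma
  assumes "sets M = sets (restrict_space borel (S_space \<times> S_space))"
  shows borel_measurable_fst_S: "fst \<in> borel_measurable M"
    and borel_measurable_snd_S: "snd \<in> borel_measurable M"
    and measurable_fst_S: "fst \<in> M \<rightarrow>\<^sub>M restrict_space borel S_space"
    and measurable_snd_S: "snd \<in> M \<rightarrow>\<^sub>M restrict_space borel S_space"
    and psd_fst_S: "p \<in> space M \<Longrightarrow> psd (snd (fst p))"
    and psd_snd_S: "p \<in> space M \<Longrightarrow> psd (snd (snd p))"
proof -
  have space: "space M = S_space \<times> S_space"
    using sets_eq_imp_space_eq[OF assms] by (simp add: space_restrict_space)
  show *: "fst \<in> borel_measurable M" "snd \<in> borel_measurable M"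
    unfolding measurable_cong_sets[OF assms refl]
    by (intro measurable_restrict_space1 borel_measurable_continuous_onI continuous_intros)+
  show "fst \<in> M \<rightarrow>\<^sub>M restrict_space borel S_space" "snd \<in> M \<rightarrow>\<^sub>M restrict_space borel S_space"
    using * by (auto intro!: measurable_restrict_space2 simp: space)
  show "p \<in> space M \<Longrightarrow> psd (snd (fst p))" "p \<in> space M \<Longrightarrow> psd (snd (snd p))"
    by (auto simp: space S_space_def)
qed

lemma nn_integral_distr_gaussian:
  fixes w :: "'a \<Rightarrow> (real^'n) \<times> (real^'n^'n)"
  assumes "w \<in> M \<rightarrow>\<^sub>M restrict_space borel S_space" "A \<in> sets borel"
  shows "(\<integral>\<^sup>+s. emeasure (gaussian s) A \<partial>distr M (restrict_space borel S_space) w)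
    = (\<integral>\<^sup>+z. emeasure (gaussian (w z)) A \<partial>M)"
proof (rule nn_integral_distr[OF assms(1)])
  show "(\<lambda>s. emeasure (gaussian s) A) \<in> borel_measurable
      (distr M (restrict_space borel S_space) w)"
    using assms(2) by (intro borel_measurable_emeasure_gaussian)
      (auto simp: space_restrict_space S_space_def measurable_restrict_space1)
qed

text \<open>Use the image of \<open>\<nu>\<close> under \<open>(y\<^sub>1, y\<^sub>2) \<mapsto> ((y\<^sub>1, 0), (y\<^sub>2, 0))\<close>.  The blocks of a mixing measure of
  \<open>\<nu>\<close> would not do: \<open>GM2\<close> bounds only the first moment of the covariances, whereas
  \<open>param_couplings\<close> asks for the second.\<close>

lemma W2_prm_le_cost:
  assumes \<nu>: "\<nu> \<in> couplings \<mu>1 \<mu>2" "\<nu> \<in> GM2"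
  shows "W2_prm \<mu>1 \<mu>2 \<le> (\<integral>\<^sup>+(y1, y2). ennreal ((norm (y1 - y2))\<^sup>2) \<partial>\<nu>)"
proof -
  have sets [measurable_cong]: "sets \<nu> = sets borel" and prob: "prob_space \<nu>"
    and marg: "distr \<nu> borel fst = \<mu>1" "distr \<nu> borel snd = \<mu>2"
    using \<nu>(1) by (auto simp: couplings_def)
  have fin: "(\<integral>\<^sup>+y. ennreal ((norm y)\<^sup>2) \<partial>\<nu>) < \<infinity>"
    using \<nu>(2) by (simp add: GM2_iff)
  define d where "d = (\<lambda>y :: (real^'a) \<times> (real^'a). ((fst y, 0 :: real^'a^'a), (snd y, 0 :: real^'a^'a)))"
  let ?P = "restrict_space borel (S_space \<times> S_space) ::
    (((real^'a) \<times> (real^'a^'a)) \<times> ((real^'a) \<times> (real^'a^'a))) measure"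
  define \<pi> where "\<pi> = distr \<nu> ?P d"
  have d: "d \<in> \<nu> \<rightarrow>\<^sub>M ?P"
    unfolding d_def by (intro measurable_restrict_space2) (auto simp: S_space_def psd_0)
  note [measurable] = borel_measurable_fst_S[of ?P, OF refl] borel_measurable_snd_S[of ?P, OF refl]
  have sets_\<pi>: "sets \<pi> = sets ?P" by (simp add: \<pi>_def)
  have marg_eq: "(\<integral>\<^sup>+s. emeasure (gaussian s) A \<partial>distr \<pi> (restrict_space borel S_space) g) = emeasure (distr \<nu> borel h) A"
    if A: "A \<in> sets borel" and g: "g \<in> ?P \<rightarrow>\<^sub>M restrict_space borel S_space"
      and h: "h \<in> borel_measurable \<nu>" and gd: "\<And>y. g (d y) = (h y, 0)"
    for A and g :: "_ \<Rightarrow> (real^'a) \<times> (real^'a^'a)" and h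
  proof -
    have "distr \<pi> (restrict_space borel S_space) g = distr \<nu> (restrict_space borel S_space) (g \<circ> d)"
      unfolding \<pi>_def by (rule distr_distr[OF g d])
    then have "(\<integral>\<^sup>+s. emeasure (gaussian s) A \<partial>distr \<pi> (restrict_space borel S_space) g)
        = (\<integral>\<^sup>+y. indicator A (h y) \<partial>\<nu>)"
      using measurable_comp[OF d g] A by (simp add: nn_integral_distr_gaussian gd)
    then show ?thesis
      using A h by (simp add: emeasure_distr_indicator)
  qed
  have "\<pi> \<in> param_couplings \<mu>1 \<mu>2"
    unfolding param_couplings_def
  proof (intro CollectI conjI ballI)
    show "sets \<pi> = sets ?P" by fact
    show "prob_space \<pi>"
      unfolding \<pi>_def by (rule prob_space.prob_space_distr[OF prob d])
    have "(\<integral>\<^sup>+((m1, Q1), (m2, Q2)).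
          ennreal ((norm m1)\<^sup>2 + (norm m2)\<^sup>2 + (norm Q1)\<^sup>2 + (norm Q2)\<^sup>2) \<partial>\<pi>)
        = (\<integral>\<^sup>+y. ennreal ((norm y)\<^sup>2) \<partial>\<nu>)"
      unfolding \<pi>_def split_beta
      by (subst nn_integral_distr[OF d]) (simp_all add: d_def power2_norm_Pair)
    then show "(\<integral>\<^sup>+((m1, Q1), (m2, Q2)).
          ennreal ((norm m1)\<^sup>2 + (norm m2)\<^sup>2 + (norm Q1)\<^sup>2 + (norm Q2)\<^sup>2) \<partial>\<pi>) < \<infinity>"
      using fin by simp
    show "(\<integral>\<^sup>+s. emeasure (gaussian s) A \<partial>distr \<pi> (restrict_space borel S_space) fst) = emeasure \<mu>1 A"
      if "A \<in> sets borel" for A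
      using marg_eq[OF that measurable_fst_S[OF refl], of fst] by (simp add: d_def marg)
    show "(\<integral>\<^sup>+s. emeasure (gaussian s) A \<partial>distr \<pi> (restrict_space borel S_space) snd) = emeasure \<mu>2 A"
      if "A \<in> sets borel" for A
      using marg_eq[OF that measurable_snd_S[OF refl], of snd] by (simp add: d_def marg)
  qed
  then have "W2_prm \<mu>1 \<mu>2 \<le> (\<integral>\<^sup>+(s1, s2). ennreal (bw_dist_sq s1 s2) \<partial>\<pi>)"
    unfolding W2_prm_def by (rule INF_lower)
  also have "\<dots> = (\<integral>\<^sup>+y. ennreal (bw_dist_sq (fst (d y)) (snd (d y))) \<partial>\<nu>)"
    unfolding \<pi>_def split_beta
  proof (rule nn_integral_distr[OF d])
    have "(\<lambda>p. bw_dist_sq (fst p) (snd p)) \<in> borel_measurable ?P"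
      by (intro borel_measurable_bw_dist_sq borel_measurable_fst_S[OF refl]
          borel_measurable_snd_S[OF refl]) (auto simp: space_restrict_space S_space_def)
    then show "(\<lambda>p. ennreal (bw_dist_sq (fst p) (snd p))) \<in> borel_measurable (distr \<nu> ?P d)"
      by simp
  qed
  also have "\<dots> = (\<integral>\<^sup>+(y1, y2). ennreal ((norm (y1 - y2))\<^sup>2) \<partial>\<nu>)"
    unfolding case_prod_unfold by (simp add: d_def bw_dist_sq_def trace_0[simplified mat_0])
  finally show ?thesis .
qed

text \<open>A countable dense set of rotations is optimal up to any \<open>\<epsilon>\<close>, which later turns the choice of a
  coupling into a search for the least good index.  This choice is measurable in the parameters,
  whereas an optimal rotation is not unique when the covariances are singular and a measurable
  selection of it would need an argument of its own.\<close>

lemma countable_near_optimal_rotations: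
  obtains V :: "nat \<Rightarrow> real^'n^'n" where "\<And>k. orthogonal_matrix (V k)"
    "\<And>m1 m2 Q1 Q2 \<epsilon>. psd Q1 \<Longrightarrow> psd Q2 \<Longrightarrow> 0 < \<epsilon> \<Longrightarrow>
      \<exists>k. (norm (m1 - m2))\<^sup>2 + (norm (psd_sqrt Q1 - psd_sqrt Q2 ** V k))\<^sup>2 < bw_dist_sq (m1, Q1) (m2, Q2) + \<epsilon>"
proof -
  obtain T :: "(real^'n^'n) set" where T: "countable T" "T \<subseteq> {U. orthogonal_matrix U}"
    "{U. orthogonal_matrix U} \<subseteq> closure T"
    by (rule separable)
  have "T \<noteq> {}"
    using T(3) orthogonal_matrix_id by auto
  define V where "V = from_nat_into T"
  have V: "range V = T"
    unfolding V_def using \<open>T \<noteq> {}\<close> \<open>countable T\<close> by (rule range_from_nat_into)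
  show thesis
  proof
    show "orthogonal_matrix (V k)" for k
      using V T(2) by blast
    fix m1 m2 :: "real^'n" and Q1 Q2 :: "real^'n^'n" and \<epsilon> :: real
    assume "psd Q1" "psd Q2" "0 < \<epsilon>"
    define g where "g U = (norm (m1 - m2))\<^sup>2 + (norm (psd_sqrt Q1 - psd_sqrt Q2 ** U))\<^sup>2" for U
    obtain U where U: "orthogonal_matrix U" "bw_dist_sq (m1, Q1) (m2, Q2) = g U"
      using bw_dist_sq_attained[OF \<open>psd Q1\<close> \<open>psd Q2\<close>] unfolding g_def by metis
    obtain u where u: "\<And>j. u j \<in> T" "u \<longlonglongrightarrow> U"
      using U(1) T(3) closure_sequential by blast
    have "continuous_on UNIV g"
      unfolding g_def matrix_matrix_mult_def by (intro continuous_intros)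
    then have "(\<lambda>j. g (u j)) \<longlonglongrightarrow> g U"
      using u(2) by (rule continuous_on_tendsto_compose) auto
    then have "eventually (\<lambda>j. g (u j) < g U + \<epsilon>) sequentially"
      by (rule order_tendstoD) (use \<open>0 < \<epsilon>\<close> in simp)
    then obtain j where "g (u j) < g U + \<epsilon>"
      by (auto simp: eventually_sequentially)
    moreover obtain k where "V k = u j"
      using u(1)[of j] V by (metis imageE)
    ultimately show "\<exists>k. (norm (m1 - m2))\<^sup>2 + (norm (psd_sqrt Q1 - psd_sqrt Q2 ** V k))\<^sup>2
        < bw_dist_sq (m1, Q1) (m2, Q2) + \<epsilon>"
      using U(2) by (intro exI[of _ k]) (simp add: g_def)
  qed
qed

text \<open>This makes the first moment of a covariance finite whenever its second moment is.\<close>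

lemma trace_le_power2_norm: "trace Q \<le> CARD('n) + (norm Q)\<^sup>2" for Q :: "real^'n^'n"
proof -
  have "Q $ i $ i \<le> 1 + (Q $ i $ i)\<^sup>2" for i
    using zero_le_power2[of "Q $ i $ i - 1/2"] by (simp add: power2_eq_square algebra_simps)
  moreover have "(Q $ i $ i)\<^sup>2 \<le> (norm (Q $ i))\<^sup>2" for i
    using power_mono[OF component_le_norm_cart[of "Q $ i" i], of 2] by simp
  ultimately have "trace Q \<le> (\<Sum>i\<in>UNIV. 1 + (norm (Q $ i))\<^sup>2)"
    unfolding trace_def by (intro sum_mono) (meson add_left_mono order_trans)
  also have "\<dots> = CARD('n) + (norm Q)\<^sup>2"
    by (simp add: sum.distrib) (simp add: power2_norm_eq_inner inner_vec_def[of Q])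
  finally show ?thesis .
qed

text \<open>Draw the parameters \<open>((m\<^sub>1, Q\<^sub>1), (m\<^sub>2, Q\<^sub>2))\<close> from \<open>\<pi>\<close> and an independent standard Gaussian \<open>X\<close>, and
  couple \<open>m\<^sub>1 + Q\<^sub>1\<^sup>1\<^sup>/\<^sup>2 X\<close> with \<open>m\<^sub>2 + Q\<^sub>2\<^sup>1\<^sup>/\<^sup>2 V X\<close>, where the rotation \<open>V\<close> is the first one in the
  dense sequence that is good enough for these parameters.\<close>

lemma W2_mix_le_cost:
  fixes \<mu>1 \<mu>2 :: "(real^'n) measure"
  assumes \<mu>: "sets \<mu>1 = sets borel" "sets \<mu>2 = sets borel"
    and \<pi>: "\<pi> \<in> param_couplings \<mu>1 \<mu>2" and "0 < \<epsilon>"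
  shows "W2_mix \<mu>1 \<mu>2 \<le> (\<integral>\<^sup>+(s1, s2). ennreal (bw_dist_sq s1 s2) \<partial>\<pi>) + ennreal \<epsilon>"
proof -
  have sets: "sets \<pi> = sets (restrict_space borel (S_space \<times> S_space))"
    and prob: "prob_space \<pi>"
    and fin: "(\<integral>\<^sup>+p. ennreal ((norm (fst (fst p)))\<^sup>2 + (norm (fst (snd p)))\<^sup>2
        + (norm (snd (fst p)))\<^sup>2 + (norm (snd (snd p)))\<^sup>2) \<partial>\<pi>) < \<infinity>"
    and marg1: "\<And>A. A \<in> sets borel \<Longrightarrow>
      (\<integral>\<^sup>+s. emeasure (gaussian s) A \<partial>distr \<pi> (restrict_space borel S_space) fst) = emeasure \<mu>1 A"
    and marg2: "\<And>A. A \<in> sets borel \<Longrightarrow>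
      (\<integral>\<^sup>+s. emeasure (gaussian s) A \<partial>distr \<pi> (restrict_space borel S_space) snd) = emeasure \<mu>2 A"
    using \<pi> unfolding param_couplings_def split_beta by blast+
  interpret \<pi>: prob_space \<pi> by (rule prob)
  note [measurable] = borel_measurable_fst_S[OF sets] borel_measurable_snd_S[OF sets]
  note psd = psd_fst_S[OF sets] psd_snd_S[OF sets]
  have [measurable]: "(\<lambda>p. psd_sqrt (snd (fst p))) \<in> borel_measurable \<pi>"
    "(\<lambda>p. psd_sqrt (snd (snd p))) \<in> borel_measurable \<pi>"
    by (intro borel_measurable_psd_sqrt psd; measurable)+
  have [measurable]: "(\<lambda>p. bw_dist_sq (fst p) (snd p)) \<in> borel_measurable \<pi>"
    by (intro borel_measurable_bw_dist_sq psd) measurable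
  obtain V :: "nat \<Rightarrow> real^'n^'n" where V: "\<And>k. orthogonal_matrix (V k)"
    and V_dense: "\<And>m1 m2 Q1 Q2 \<epsilon>. psd Q1 \<Longrightarrow> psd Q2 \<Longrightarrow> 0 < \<epsilon> \<Longrightarrow>
      \<exists>k. (norm (m1 - m2))\<^sup>2 + (norm (psd_sqrt Q1 - psd_sqrt Q2 ** V k))\<^sup>2 < bw_dist_sq (m1, Q1) (m2, Q2) + \<epsilon>"
    using countable_near_optimal_rotations by metis
  define cost :: "((real^'n) \<times> (real^'n^'n)) \<times> ((real^'n) \<times> (real^'n^'n)) \<Rightarrow> nat \<Rightarrow> real"
    where "cost p k = (norm (fst (fst p) - fst (snd p)))\<^sup>2
      + (norm (psd_sqrt (snd (fst p)) - psd_sqrt (snd (snd p)) ** V k))\<^sup>2" for p k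
  define K where "K p = (LEAST k. cost p k < bw_dist_sq (fst p) (snd p) + \<epsilon>)" for p
  have [measurable]: "(\<lambda>p. cost p k) \<in> borel_measurable \<pi>" for k
    unfolding cost_def by measurable
  have [measurable]: "K \<in> \<pi> \<rightarrow>\<^sub>M count_space UNIV"
    unfolding K_def by measurable
  have K: "cost p (K p) < bw_dist_sq (fst p) (snd p) + \<epsilon>" if "p \<in> space \<pi>" for p
    unfolding K_def
  proof (rule LeastI_ex)
    show "\<exists>k. cost p k < bw_dist_sq (fst p) (snd p) + \<epsilon>"
      using V_dense[OF psd(1)[OF that] psd(2)[OF that] \<open>0 < \<epsilon>\<close>, of "fst (fst p)" "fst (snd p)"]
      by (simp add: cost_def)
  qed
  \<comment> \<open>The matrix that replaces \<open>Q\<^sub>2\<^sup>1\<^sup>/\<^sup>2\<close> in the second component, and \<open>F\<close> the coupled pair as a function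
    of the parameters and the Gaussian.\<close>
  define G where "G p = psd_sqrt (snd (snd p)) ** V (K p)" for p
  have [measurable]: "(\<lambda>p. V (K p)) \<in> borel_measurable \<pi>"
    by (rule measurable_compose[of K _ "count_space UNIV"]) simp_all
  have [measurable]: "G \<in> borel_measurable \<pi>"
    unfolding G_def by measurable
  define F where "F q = (fst (fst (fst q)) + psd_sqrt (snd (fst (fst q))) *v snd q,
      fst (snd (fst q)) + G (fst q) *v snd q)" for q
  have F [measurable]: "F \<in> borel_measurable (\<pi> \<Otimes>\<^sub>M std_gaussian)"
    unfolding F_def by measurable
  define \<nu> where "\<nu> = distr (\<pi> \<Otimes>\<^sub>M std_gaussian) borel F"
  interpret pair: pair_prob_space \<pi> "std_gaussian :: (real^'n) measure" ..
  have prob_\<nu>: "prob_space \<nu>"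
    unfolding \<nu>_def by (rule pair.prob_space_distr) measurable
  have sets_\<nu>: "sets \<nu> = sets borel" by (simp add: \<nu>_def)
  have distr_eq: "distr \<nu> borel h = \<mu>"
    if h: "h \<in> borel_measurable borel" and "sets \<mu> = sets borel" and g: "g \<in> \<pi> \<rightarrow>\<^sub>M restrict_space borel S_space"
      and marg: "\<And>A. A \<in> sets borel \<Longrightarrow>
        (\<integral>\<^sup>+s. emeasure (gaussian s) A \<partial>distr \<pi> (restrict_space borel S_space) g) = emeasure \<mu> A"
      and law: "\<And>p. distr std_gaussian borel (\<lambda>x. h (F (p, x))) = gaussian (g p)"
    for h :: "_ \<Rightarrow> real^'n" and \<mu> g
  proof (rule measure_eqI)
    fix A assume "A \<in> sets (distr \<nu> borel h)"
    then have A: "A \<in> sets borel" by simp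
    have "distr \<nu> borel h = distr (\<pi> \<Otimes>\<^sub>M std_gaussian) borel (h \<circ> F)"
      unfolding \<nu>_def by (rule distr_distr[OF h F])
    then have "emeasure (distr \<nu> borel h) A = (\<integral>\<^sup>+p. emeasure (gaussian (g p)) A \<partial>\<pi>)"
      using measurable_comp[OF F h] A by (simp add: emeasure_distr_pair_std_gaussian law)
    then show "emeasure (distr \<nu> borel h) A = emeasure \<mu> A"
      using marg[OF A] by (simp add: nn_integral_distr_gaussian[OF g A])
  qed (simp add: that(2))
  have "distr \<nu> borel fst = \<mu>1"
    by (rule distr_eq[OF _ \<mu>(1) measurable_fst_S[OF sets] marg1])
      (auto simp: F_def gaussian_def split_beta intro!: borel_measurable_continuous_onI continuous_intros)
  moreover have "distr \<nu> borel snd = \<mu>2"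
    by (rule distr_eq[OF _ \<mu>(2) measurable_snd_S[OF sets] marg2])
      (auto simp: F_def G_def gaussian_orthogonal[OF V] intro!: borel_measurable_continuous_onI continuous_intros)
  ultimately have "\<nu> \<in> couplings \<mu>1 \<mu>2"
    using prob_\<nu> sets_\<nu> by (simp add: couplings_def)
  moreover have "\<nu> \<in> GM2"
    unfolding GM2_iff
  proof (intro conjI sets_\<nu> prob_\<nu>)
    have [measurable]: "(*v) C \<in> borel_measurable borel" for C :: "real^'n^'n"
      by (intro borel_measurable_continuous_onI continuous_intros)
    have "(\<integral>\<^sup>+y. ennreal ((norm y)\<^sup>2) \<partial>\<nu>) = (\<integral>\<^sup>+p. \<integral>\<^sup>+x. ennreal ((norm (F (p, x)))\<^sup>2) \<partial>std_gaussian \<partial>\<pi>)"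
      unfolding \<nu>_def by (rule nn_integral_distr_pair_std_gaussian[OF F]) measurable
    also have "\<dots> = (\<integral>\<^sup>+p. ennreal ((norm (fst (fst p)))\<^sup>2 + (norm (psd_sqrt (snd (fst p))))\<^sup>2)
        + ennreal ((norm (fst (snd p)))\<^sup>2 + (norm (G p))\<^sup>2) \<partial>\<pi>)"
      by (simp add: F_def power2_norm_Pair nn_integral_add nn_integral_std_gaussian_affine del: ennreal_plus)
        (simp add: nn_integral_add nn_integral_std_gaussian_affine del: ennreal_plus[of "_ + _"])
    also have "\<dots> \<le> (\<integral>\<^sup>+p. ennreal (2 * CARD('n)) + ennreal ((norm (fst (fst p)))\<^sup>2 + (norm (fst (snd p)))\<^sup>2
        + (norm (snd (fst p)))\<^sup>2 + (norm (snd (snd p)))\<^sup>2) \<partial>\<pi>)"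
    proof (rule nn_integral_mono)
      fix p assume p: "p \<in> space \<pi>"
      have "(norm (psd_sqrt (snd (fst p))))\<^sup>2 \<le> CARD('n) + (norm (snd (fst p)))\<^sup>2"
        "(norm (G p))\<^sup>2 \<le> CARD('n) + (norm (snd (snd p)))\<^sup>2"
        using trace_le_power2_norm psd[OF p]
        by (simp_all add: G_def norm_mult_orthogonal_matrix[OF V] power2_norm_psd_sqrt)
      then show "ennreal ((norm (fst (fst p)))\<^sup>2 + (norm (psd_sqrt (snd (fst p))))\<^sup>2)
          + ennreal ((norm (fst (snd p)))\<^sup>2 + (norm (G p))\<^sup>2)
        \<le> ennreal (2 * CARD('n)) + ennreal ((norm (fst (fst p)))\<^sup>2 + (norm (fst (snd p)))\<^sup>2
          + (norm (snd (fst p)))\<^sup>2 + (norm (snd (snd p)))\<^sup>2)"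
        by (simp add: ennreal_plus[symmetric] ennreal_leI del: ennreal_plus)
    qed
    also have "\<dots> = ennreal (2 * CARD('n)) + (\<integral>\<^sup>+p. ennreal ((norm (fst (fst p)))\<^sup>2 + (norm (fst (snd p)))\<^sup>2
        + (norm (snd (fst p)))\<^sup>2 + (norm (snd (snd p)))\<^sup>2) \<partial>\<pi>)"
      by (subst nn_integral_add) (simp_all add: \<pi>.emeasure_space_1)
    also have "\<dots> < \<infinity>"
      using fin by (simp add: ennreal_add_eq_top less_top)
    finally show "(\<integral>\<^sup>+y. ennreal ((norm y)\<^sup>2) \<partial>\<nu>) < \<infinity>" .
  qed
  ultimately have "W2_mix \<mu>1 \<mu>2 \<le> (\<integral>\<^sup>+(y1, y2). ennreal ((norm (y1 - y2))\<^sup>2) \<partial>\<nu>)"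
    unfolding W2_mix_def by (intro INF_lower) simp
  also have "\<dots> = (\<integral>\<^sup>+p. \<integral>\<^sup>+x. ennreal ((norm (fst (F (p, x)) - snd (F (p, x))))\<^sup>2) \<partial>std_gaussian \<partial>\<pi>)"
    unfolding \<nu>_def split_beta by (rule nn_integral_distr_pair_std_gaussian[OF F]) measurable
  also have "\<dots> = (\<integral>\<^sup>+p. ennreal (cost p (K p)) \<partial>\<pi>)"
  proof (rule nn_integral_cong)
    fix p
    have "fst (F (p, x)) - snd (F (p, x))
        = (fst (fst p) - fst (snd p)) + (psd_sqrt (snd (fst p)) - G p) *v x" for x
      by (simp add: F_def matrix_vector_mult_diff_rdistrib)
    then show "(\<integral>\<^sup>+x. ennreal ((norm (fst (F (p, x)) - snd (F (p, x))))\<^sup>2) \<partial>std_gaussian) = ennreal (cost p (K p))"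
      by (simp add: nn_integral_std_gaussian_affine cost_def G_def del: ennreal_plus)
  qed
  also have "\<dots> \<le> (\<integral>\<^sup>+p. ennreal (bw_dist_sq (fst p) (snd p)) + ennreal \<epsilon> \<partial>\<pi>)"
  proof (rule nn_integral_mono)
    fix p assume p: "p \<in> space \<pi>"
    then have "ennreal (cost p (K p)) \<le> ennreal (bw_dist_sq (fst p) (snd p) + \<epsilon>)"
      using K by (intro ennreal_leI less_imp_le)
    also have "\<dots> = ennreal (bw_dist_sq (fst p) (snd p)) + ennreal \<epsilon>"
      using bw_dist_sq_nonneg[OF psd(1)[OF p] psd(2)[OF p]] \<open>0 < \<epsilon>\<close> by (intro ennreal_plus) auto
    finally show "ennreal (cost p (K p)) \<le> ennreal (bw_dist_sq (fst p) (snd p)) + ennreal \<epsilon>" .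
  qed
  also have "\<dots> = (\<integral>\<^sup>+(s1, s2). ennreal (bw_dist_sq s1 s2) \<partial>\<pi>) + ennreal \<epsilon>"
    unfolding case_prod_unfold by (subst nn_integral_add) (simp_all add: \<pi>.emeasure_space_1)
  finally show ?thesis .
qed

theorem theorem2:
  fixes \<mu>1 \<mu>2 :: "(real^'n) measure"
  assumes "sets \<mu>1 = sets borel" and "prob_space \<mu>1"
    and "sets \<mu>2 = sets borel" and "prob_space \<mu>2"
  shows "W2_mix \<mu>1 \<mu>2 = W2_prm \<mu>1 \<mu>2"
proof (rule antisym)
  show "W2_mix \<mu>1 \<mu>2 \<le> W2_prm \<mu>1 \<mu>2"
    unfolding W2_prm_def
  proof (rule INF_greatest)
    fix \<pi> :: "(((real^'n) \<times> (real^'n^'n)) \<times> ((real^'n) \<times> (real^'n^'n))) measure"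
    assume "\<pi> \<in> param_couplings \<mu>1 \<mu>2"
    then have "W2_mix \<mu>1 \<mu>2 \<le> (\<integral>\<^sup>+(s1, s2). ennreal (bw_dist_sq s1 s2) \<partial>\<pi>) + ennreal \<epsilon>"
      if "0 < \<epsilon>" for \<epsilon>
      using that by (rule W2_mix_le_cost[OF assms(1,3)])
    then show "W2_mix \<mu>1 \<mu>2 \<le> (\<integral>\<^sup>+(s1, s2). ennreal (bw_dist_sq s1 s2) \<partial>\<pi>)"
      by (rule ennreal_le_epsilon)
  qed
  show "W2_prm \<mu>1 \<mu>2 \<le> W2_mix \<mu>1 \<mu>2"
    unfolding W2_mix_def
  proof (rule INF_greatest)
    fix \<nu> assume "\<nu> \<in> couplings \<mu>1 \<mu>2 \<inter> GM2"
    then show "W2_prm \<mu>1 \<mu>2 \<le> (\<integral>\<^sup>+(y1, y2). ennreal ((norm (y1 - y2))\<^sup>2) \<partial>\<nu>)"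
      by (intro W2_prm_le_cost) simp_all
  qed
qed

end
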